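(* Let $n,n_{tw}\ge1$ be integers, $d=\gcd(n,n_{tw})$, $n''=n/d$, $n'=n_{tw}/d$, $N\ge1$, $q,v,u_0,\dots,u_{n-1}\in\mathbb{C}^*$. The operators $\mathbf{B}_1,\dots,\mathbf{B}_N$ acting on $\mathbf{C}^{(n,n_{tw})}_{u_0,\dots,u_{n-1}}=(\mathbb{C}^n[Y^{\pm1}])^{\otimes N}$ are triangular in the basis $e_\lambda$, $\lambda\in\mathbb{Z}^N$, with respect to the order $\prec$, i.e. $\mathbf{B}_ie_\lambda\in\mathbb{C}e_\lambda+\sum_{\mu\prec\lambda}\mathbb{C}e_\mu$.
   Context: **Representation.** $V=\mathbb{C}^n[Y^{\pm1}]$, $\mathbb{C}^n$ with basis $e_0,\dots,e_{n-1}$; $e_{nj+a}=Y^je_a$ ($j\in\mathbb{Z}$, $0\le a<n$); $e_\lambda=e_{\lambda_1}\otimes\dots\otimes e_{\lambda_N}$. On $V^{\otimes N}=(\mathbb{C}^n)^{\otimes N}[Y_1^{\pm1},\dots,Y_N^{\pm1}]$ there are operators: multiplication by $Y_i$; $T_i=s_i^YR_{i,i+1}+(v-v^{-1})\frac{s_i^Y-1}{Y_i/Y_{i+1}-1}$, where $s_i^Y$ swaps only the variables $Y_i,Y_{i+1}$ and $R=v\sum_aE_{aa}\otimes E_{aa}+\sum_{a<b}(E_{ab}\otimes E_{ba}+E_{ba}\otimes E_{ab}+(v-v^{-1})E_{aa}\otimes E_{bb})$; $\pi=\kappa_1^{n_{tw}}D_1s_1\cdots s_{N-1}$, where $s_i$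 swaps tensor factors $i,i+1$ of $V^{\otimes N}$, $\kappa e_i=e_{i-1}$, $D(Y^je_a)=u_aq^jY^je_a$ ($0\le a<n$), subscript $1$ = acting on the first factor. These give an action of the double affine Hecke algebra, denoted $\mathbf{C}^{(n,n_{tw})}_{u_0,\dots,u_{n-1}}$. $X_1=T_1\cdots T_{N-1}\pi^{-1}$. **Operators.** $\mathbf{B}_1=Z_1\cdots Z_{n''+n'}$ with $Z_j=Y_1$ if $\lfloor\frac{jn''}{n''+n'}\rfloor=\lfloor\frac{(j-1)n''}{n''+n'}\rfloor$ and $Z_j=X_1^{-1}$ otherwise; $\mathbf{B}_{i+1}=T_i\cdots T_1\mathbf{B}_1T_1\cdots T_i$. **Order.** For $\lambda,\mu\in\mathbb{Z}^N$, $\lambda\le\mu$ means $\mu-\lambda$ is a nonnegative integer combination of the simple roots $\epsilon_i-\epsilon_{i+1}$; $\lambda^+$ is the weakly decreasing rearrangement of $\lambda$. $\lambda\prec\mu$ iff $\lambda^+<\mu^+$, or $\lambda^+=\mu^+$ and $\lambda<\mu$. *)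

theory Defs
  imports Complex_Main "HOL-Library.Poly_Mapping"
begin

text \<open>
  The tensor power \<open>V\<^sup>\<otimes>\<^sup>N\<close> of \<open>V = \<complex>\<^sup>n[Y, Y\<^sup>-\<^sup>1]\<close> is presented in coordinates with respect to its
  basis \<open>e\<^sub>l\<close>, \<open>l \<in> \<int>\<^sup>N\<close>: a weight \<open>l\<close> is an integer list of length \<open>N\<close>, a vector is a finitely
  supported complex function on weights. Since \<open>e\<^bsub>nj+a\<^esub> = Y\<^sup>j e\<^sub>a\<close> for \<open>0 \<le> a < n\<close>, the entry
  \<open>l\<^sub>i\<close> encodes the exponent \<open>l\<^sub>i div n\<close> of \<open>Y\<^sub>i\<close> and the index \<open>l\<^sub>i mod n\<close> of the basis vector of
  \<open>\<complex>\<^sup>n\<close> in the \<open>i\<close>-th factor. Tensor factors are numbered \<open>1, \<dots>, N\<close>, so that \<open>l\<^sub>i\<close> is the list entry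
  at position \<open>i - 1\<close>.
\<close>

type_synonym weight = "int list"
type_synonym vec = "weight \<Rightarrow>\<^sub>0 complex"
type_synonym oper = "vec \<Rightarrow> vec"

definition tensor_space :: "nat \<Rightarrow> vec set" where
  "tensor_space N = {f. \<forall>l\<in>Poly_Mapping.keys f. length l = N}"

definition e :: "weight \<Rightarrow> vec" where
  "e l = Poly_Mapping.single l 1"

definition scale :: "complex \<Rightarrow> vec \<Rightarrow> vec" where
  "scale c f = Poly_Mapping.map (\<lambda>x. c * x) f"

definition linear_ext :: "(weight \<Rightarrow> vec) \<Rightarrow> oper" where
  "linear_ext F f = (\<Sum>l\<in>Poly_Mapping.keys f. scale (Poly_Mapping.lookup f l) (F l))"

definition entry :: "weight \<Rightarrow> nat \<Rightarrow> int" where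
  "entry l i = l ! (i - 1)"

definition set_entry :: "weight \<Rightarrow> nat \<Rightarrow> int \<Rightarrow> weight" where
  "set_entry l i x = l[i - 1 := x]"

definition comps :: "oper list \<Rightarrow> oper" where
  "comps Fs = foldr (\<circ>) Fs id"

text \<open>Multiplication by \<open>Y\<^sub>i\<^sup>k\<close>, for an integer \<open>k\<close>.\<close>

definition Y_pow :: "nat \<Rightarrow> nat \<Rightarrow> int \<Rightarrow> oper" where
  "Y_pow n i k = linear_ext (\<lambda>l. e (set_entry l i (entry l i + int n * k)))"

text \<open>\<open>s_Y\<close> exchanges only the variables \<open>Y\<^sub>i, Y\<^bsub>i+1\<^esub>\<close>; \<open>s_fac\<close> exchanges the tensor factors of \<open>V\<^sup>\<otimes>\<^sup>N\<close>.\<close>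

definition s_Y :: "nat \<Rightarrow> nat \<Rightarrow> oper" where
  "s_Y n i = linear_ext (\<lambda>l.
     e (set_entry
         (set_entry l i (int n * (entry l (i + 1) div int n) + entry l i mod int n))
         (i + 1) (int n * (entry l i div int n) + entry l (i + 1) mod int n)))"

definition s_fac :: "nat \<Rightarrow> oper" where
  "s_fac i = linear_ext (\<lambda>l.
     e (set_entry (set_entry l i (entry l (i + 1))) (i + 1) (entry l i)))"

text \<open>The matrix unit \<open>E\<^sub>a\<^sub>b\<close> (\<open>e\<^sub>b \<mapsto> e\<^sub>a\<close>) on the \<open>\<complex>\<^sup>n\<close> of the \<open>i\<close>-th factor.\<close>

definition E :: "nat \<Rightarrow> nat \<Rightarrow> nat \<Rightarrow> nat \<Rightarrow> oper" where
  "E n i a b = linear_ext (\<lambda>l.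
     if entry l i mod int n = int b then e (set_entry l i (entry l i - int b + int a)) else 0)"

text \<open>\<open>R\<^bsub>i,i+1\<^esub>\<close>\<close>

definition R :: "nat \<Rightarrow> complex \<Rightarrow> nat \<Rightarrow> oper" where
  "R n v i f =
     scale v (\<Sum>a<n. E n i a a (E n (i + 1) a a f)) +
     (\<Sum>b<n. \<Sum>a<b.
        E n i a b (E n (i + 1) b a f) +
        E n i b a (E n (i + 1) a b f) +
        scale (v - inverse v) (E n i a a (E n (i + 1) b b f)))"

text \<open>
  \<open>(s\<^sub>i\<^sup>Y - 1) f / (Y\<^sub>i / Y\<^bsub>i+1\<^esub> - 1)\<close>. The quotient is unique because \<open>V\<^sup>\<otimes>\<^sup>N\<close> is a free module over the
  Laurent polynomial ring; it exists for \<open>1 \<le> i < N\<close>, \<open>n \<ge> 1\<close> and \<open>f\<close> in \<open>V\<^sup>\<otimes>\<^sup>N\<close>.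
\<close>

definition div_diff :: "nat \<Rightarrow> nat \<Rightarrow> nat \<Rightarrow> oper" where
  "div_diff n N i f =
     (THE g. g \<in> tensor_space N \<and> Y_pow n i 1 (Y_pow n (i + 1) (-1) g) - g = s_Y n i f - f)"

definition T :: "nat \<Rightarrow> nat \<Rightarrow> complex \<Rightarrow> nat \<Rightarrow> oper" where
  "T n N v i f = s_Y n i (R n v i f) + scale (v - inverse v) (div_diff n N i f)"

text \<open>\<open>\<kappa>\<^sub>1\<close> and \<open>D\<^sub>1\<close>: the operators \<open>\<kappa>\<close>, \<open>D\<close> acting on the first factor.\<close>

definition kappa1 :: oper where
  "kappa1 = linear_ext (\<lambda>l. e (set_entry l 1 (entry l 1 - 1)))"

definition D1 :: "nat \<Rightarrow> complex \<Rightarrow> (nat \<Rightarrow> complex) \<Rightarrow> oper" where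
  "D1 n q u = linear_ext (\<lambda>l.
     scale (u (nat (entry l 1 mod int n)) * q powi (entry l 1 div int n)) (e l))"

definition pi_op :: "nat \<Rightarrow> nat \<Rightarrow> nat \<Rightarrow> complex \<Rightarrow> (nat \<Rightarrow> complex) \<Rightarrow> oper" where
  "pi_op n ntw N q u = (kappa1 ^^ ntw) \<circ> D1 n q u \<circ> comps (map s_fac [1..<N])"

text \<open>Inverses are taken on \<open>V\<^sup>\<otimes>\<^sup>N\<close>, where \<open>\<pi>\<close> and the \<open>T\<^sub>i\<close> (hence \<open>X\<^sub>1\<close>) are bijective.\<close>

definition X1 :: "nat \<Rightarrow> nat \<Rightarrow> nat \<Rightarrow> complex \<Rightarrow> complex \<Rightarrow> (nat \<Rightarrow> complex) \<Rightarrow> oper" where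
  "X1 n ntw N q v u =
     comps (map (T n N v) [1..<N]) \<circ> inv_into (tensor_space N) (pi_op n ntw N q u)"

definition X1_inv :: "nat \<Rightarrow> nat \<Rightarrow> nat \<Rightarrow> complex \<Rightarrow> complex \<Rightarrow> (nat \<Rightarrow> complex) \<Rightarrow> oper" where
  "X1_inv n ntw N q v u = inv_into (tensor_space N) (X1 n ntw N q v u)"

text \<open>In \<open>Z\<close> and \<open>B\<close>, \<open>n2 = n / d\<close> and \<open>n1 = n\<^sub>t\<^sub>w / d\<close> with \<open>d = gcd n n\<^sub>t\<^sub>w\<close> (\<open>n''\<close> and \<open>n'\<close>); the floors
  are natural number division.\<close>

definition Z :: "nat \<Rightarrow> nat \<Rightarrow> nat \<Rightarrow> complex \<Rightarrow> complex \<Rightarrow> (nat \<Rightarrow> complex) \<Rightarrow> nat \<Rightarrow> oper" where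
  "Z n ntw N q v u j =
     (let d = gcd n ntw; n2 = n div d; n1 = ntw div d
      in if (j * n2) div (n2 + n1) = ((j - 1) * n2) div (n2 + n1)
         then Y_pow n 1 1 else X1_inv n ntw N q v u)"

definition B1 :: "nat \<Rightarrow> nat \<Rightarrow> nat \<Rightarrow> complex \<Rightarrow> complex \<Rightarrow> (nat \<Rightarrow> complex) \<Rightarrow> oper" where
  "B1 n ntw N q v u =
     (let d = gcd n ntw; n2 = n div d; n1 = ntw div d
      in comps (map (Z n ntw N q v u) [1..<n2 + n1 + 1]))"

text \<open>\<open>B\<^sub>i = T\<^bsub>i-1\<^esub> \<cdots> T\<^sub>1 B\<^sub>1 T\<^sub>1 \<cdots> T\<^bsub>i-1\<^esub>\<close> for \<open>1 \<le> i \<le> N\<close>.\<close>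

definition B :: "nat \<Rightarrow> nat \<Rightarrow> nat \<Rightarrow> complex \<Rightarrow> complex \<Rightarrow> (nat \<Rightarrow> complex) \<Rightarrow> nat \<Rightarrow> oper" where
  "B n ntw N q v u i =
     comps (map (T n N v) (rev [1..<i])) \<circ> B1 n ntw N q v u \<circ> comps (map (T n N v) [1..<i])"

text \<open>
  \<open>\<mu> - l = \<Sum>\<^bsub>1\<le>i<N\<^esub> c\<^sub>i (\<epsilon>\<^sub>i - \<epsilon>\<^bsub>i+1\<^esub>)\<close> with natural numbers \<open>c\<^sub>i\<close>, compared at each coordinate \<open>k\<close>.
\<close>

definition dom_le :: "weight \<Rightarrow> weight \<Rightarrow> bool" where
  "dom_le l \<mu> \<longleftrightarrow> length l = length \<mu> \<and>
     (\<exists>c :: nat \<Rightarrow> nat. \<forall>k\<in>{1..length \<mu>}.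
        entry \<mu> k - entry l k =
          (\<Sum>i\<in>{1..<length \<mu>}. int (c i) * (of_bool (k = i) - of_bool (k = i + 1))))"

definition dom_less :: "weight \<Rightarrow> weight \<Rightarrow> bool" where
  "dom_less l \<mu> \<longleftrightarrow> dom_le l \<mu> \<and> l \<noteq> \<mu>"

definition dec_rearr :: "weight \<Rightarrow> weight" where
  "dec_rearr l = rev (sort l)"

definition prec :: "weight \<Rightarrow> weight \<Rightarrow> bool" where
  "prec l \<mu> \<longleftrightarrow> dom_less (dec_rearr l) (dec_rearr \<mu>) \<or>
     dec_rearr l = dec_rearr \<mu> \<and> dom_less l \<mu>"

end

theory Submission
  imports Defs "HOL-Library.Multiset"
begin

text \<open>
  The relation \<open>T\<^sub>i\<^sup>2 = (v - v\<^sup>-\<^sup>1) T\<^sub>i + 1\<close> makes the initial \<open>T\<^sub>1, \<dots>, T\<^bsub>i-1\<^esub>\<close> of \<open>B\<^sub>i\<close> cancel against the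
  last factor \<open>X\<^sub>1\<^sup>-\<^sup>1 = \<pi> T\<^bsub>N-1\<^esub>\<^sup>-\<^sup>1 \<cdots> T\<^sub>1\<^sup>-\<^sup>1\<close> of \<open>B\<^sub>1\<close>. What remains carries the \<open>i\<close>-th entry of a weight to the
  right end, moves it to the front lowered by \<open>n\<^sub>t\<^sub>w\<close>, then sends it around repeatedly (lowering it by
  \<open>n\<^sub>t\<^sub>w\<close> each time) or raises it by \<open>n\<close>, and finally carries it back to position \<open>i\<close>. If the
  carried entry is evaluated at its home position with its current shift undone, no step leaves the
  set of weights below \<open>l\<close>: \<open>T\<^sub>j\<^sup>\<plusminus>\<^sup>1\<close> exchanges two entries, or keeps them in an order that is favourable,
  or moves them strictly towards each other. The staircase shape of \<open>B\<^sub>1\<close> guarantees that \<open>X\<^sub>1\<^sup>-\<^sup>1\<close> is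
  only ever applied at shifts in \<open>[0, n)\<close>, which is what the last two cases require.
\<close>

section \<open>Linear operators on the tensor space\<close>

lemma lookup_scale [simp]: "Poly_Mapping.lookup (scale c f) l = c * Poly_Mapping.lookup f l"
  unfolding scale_def by transfer (simp add: when_def)

interpretation vec: vector_space scale
  by unfold_locales (auto intro!: poly_mapping_eqI simp: lookup_add algebra_simps)

lemma keys_scale: "Poly_Mapping.keys (scale c f) \<subseteq> Poly_Mapping.keys f"
  by (auto simp: in_keys_iff)

lemma keys_e [simp]: "Poly_Mapping.keys (e l) = {l}"
  by (simp add: e_def)

text \<open>A superset \<open>K\<close> of the support is allowed so that the coefficient at a
  chosen weight can be split off even if it vanishes.\<close>

lemma vec_expansion:
  assumes "finite K" "Poly_Mapping.keys f \<subseteq> K"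
  shows "f = (\<Sum>l\<in>K. scale (Poly_Mapping.lookup f l) (e l))"
proof (rule poly_mapping_eqI)
  fix m
  have "Poly_Mapping.lookup (\<Sum>l\<in>K. scale (Poly_Mapping.lookup f l) (e l)) m =
      (\<Sum>l\<in>K. if l = m then Poly_Mapping.lookup f m else 0)"
    unfolding lookup_sum by (rule sum.cong) (auto simp: e_def lookup_single)
  also have "\<dots> = Poly_Mapping.lookup f m"
    using assms by (auto simp: in_keys_iff subset_iff)
  finally show "Poly_Mapping.lookup f m =
      Poly_Mapping.lookup (\<Sum>l\<in>K. scale (Poly_Mapping.lookup f l) (e l)) m" by simp
qed

lemma tensor_space_iff: "f \<in> tensor_space N \<longleftrightarrow> Poly_Mapping.keys f \<subseteq> {l. length l = N}"
  by (auto simp: tensor_space_def)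

lemma e_tensor_space [simp]: "e l \<in> tensor_space N \<longleftrightarrow> length l = N"
  by (simp add: tensor_space_iff)

lemma keys_add_subset:
  "Poly_Mapping.keys f \<subseteq> S \<Longrightarrow> Poly_Mapping.keys g \<subseteq> S \<Longrightarrow> Poly_Mapping.keys (f + g) \<subseteq> S"
  by (rule order_trans[OF Poly_Mapping.keys_add Un_least])

lemma keys_diff_subset:
  "Poly_Mapping.keys f \<subseteq> S \<Longrightarrow> Poly_Mapping.keys g \<subseteq> S \<Longrightarrow> Poly_Mapping.keys (f - g) \<subseteq> S"
  for f g :: vec
  by (rule order_trans[OF Poly_Mapping.keys_diff Un_least])

lemma keys_scale_subset: "Poly_Mapping.keys f \<subseteq> S \<Longrightarrow> Poly_Mapping.keys (scale c f) \<subseteq> S"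
  by (rule order_trans[OF keys_scale])

lemma keys_sum_subset:
  "(\<And>x. x \<in> A \<Longrightarrow> Poly_Mapping.keys (f x) \<subseteq> S) \<Longrightarrow> Poly_Mapping.keys (\<Sum>x\<in>A. f x) \<subseteq> S"
  by (rule order_trans[OF Poly_Mapping.keys_sum]) blast

lemma tensor_space_zero [simp]: "0 \<in> tensor_space N"
  by (simp add: tensor_space_iff)

lemma tensor_space_add [simp]:
  "f \<in> tensor_space N \<Longrightarrow> g \<in> tensor_space N \<Longrightarrow> f + g \<in> tensor_space N"
  by (simp add: tensor_space_iff keys_add_subset)

lemma tensor_space_diff [simp]:
  "f \<in> tensor_space N \<Longrightarrow> g \<in> tensor_space N \<Longrightarrow> f - g \<in> tensor_space N"
  by (simp add: tensor_space_iff keys_diff_subset)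

lemma tensor_space_uminus [simp]: "f \<in> tensor_space N \<Longrightarrow> - f \<in> tensor_space N"
  using tensor_space_diff[of 0 N f] by simp

lemma tensor_space_scale [simp]: "f \<in> tensor_space N \<Longrightarrow> scale c f \<in> tensor_space N"
  by (simp add: tensor_space_iff keys_scale_subset)

lemma tensor_space_sum [simp]:
  "(\<And>x. x \<in> A \<Longrightarrow> f x \<in> tensor_space N) \<Longrightarrow> (\<Sum>x\<in>A. f x) \<in> tensor_space N"
  unfolding tensor_space_iff by (rule keys_sum_subset) auto

text \<open>Linearity is only required on the tensor space: \<open>div_diff\<close>, hence \<open>T\<close>, is junk elsewhere.\<close>

definition tlin :: "nat \<Rightarrow> oper \<Rightarrow> bool" where
  "tlin N F \<longleftrightarrow> (\<forall>f\<in>tensor_space N. F f \<in> tensor_space N) \<and>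
     (\<forall>f\<in>tensor_space N. \<forall>g\<in>tensor_space N. F (f + g) = F f + F g) \<and>
     (\<forall>c. \<forall>f\<in>tensor_space N. F (scale c f) = scale c (F f))"

lemma tlin_mem: "tlin N F \<Longrightarrow> f \<in> tensor_space N \<Longrightarrow> F f \<in> tensor_space N"
  and tlin_add: "tlin N F \<Longrightarrow> f \<in> tensor_space N \<Longrightarrow> g \<in> tensor_space N \<Longrightarrow> F (f + g) = F f + F g"
  and tlin_scale: "tlin N F \<Longrightarrow> f \<in> tensor_space N \<Longrightarrow> F (scale c f) = scale c (F f)"
  by (auto simp: tlin_def)

lemma tlin_zero: "tlin N F \<Longrightarrow> F 0 = 0"
  using tlin_scale[of N F 0 0] by simp

lemma tlin_diff:
  assumes "tlin N F" "f \<in> tensor_space N" "g \<in> tensor_space N"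
  shows "F (f - g) = F f - F g"
proof -
  have "F (f - g + g) = F (f - g) + F g"
    using assms by (intro tlin_add) auto
  then show ?thesis by (simp add: algebra_simps)
qed

lemma tlin_sum:
  assumes "tlin N F" "finite A" "\<And>x. x \<in> A \<Longrightarrow> f x \<in> tensor_space N"
  shows "F (\<Sum>x\<in>A. f x) = (\<Sum>x\<in>A. F (f x))"
  using assms(2,3)
  by (induction A rule: finite_induct) (auto simp: tlin_zero[OF assms(1)] tlin_add[OF assms(1)])

lemma tlin_apply:
  assumes "tlin N F" "f \<in> tensor_space N"
  shows "F f = (\<Sum>l\<in>Poly_Mapping.keys f. scale (Poly_Mapping.lookup f l) (F (e l)))"
proof -
  have len: "length l = N" if "l \<in> Poly_Mapping.keys f" for l
    using assms(2) that by (auto simp: tensor_space_def)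
  have "F f = F (\<Sum>l\<in>Poly_Mapping.keys f. scale (Poly_Mapping.lookup f l) (e l))"
    using vec_expansion[of "Poly_Mapping.keys f" f] by simp
  also have "\<dots> = (\<Sum>l\<in>Poly_Mapping.keys f. F (scale (Poly_Mapping.lookup f l) (e l)))"
    using len by (intro tlin_sum[OF assms(1)]) auto
  also have "\<dots> = (\<Sum>l\<in>Poly_Mapping.keys f. scale (Poly_Mapping.lookup f l) (F (e l)))"
    using len by (intro sum.cong) (auto intro: tlin_scale[OF assms(1)])
  finally show ?thesis .
qed

lemma tlin_eqI:
  assumes "tlin N F" "tlin N G" "\<And>l. length l = N \<Longrightarrow> F (e l) = G (e l)" "f \<in> tensor_space N"
  shows "F f = G f"
  unfolding tlin_apply[OF assms(1,4)] tlin_apply[OF assms(2,4)]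
  using assms(3,4) by (intro sum.cong) (auto simp: tensor_space_def)

text \<open>Triangularity only concerns supports, so one estimate per factor, made on basis vectors,
  can be chained through a composition. The length condition keeps everything where \<open>F\<close>
  is linear.\<close>

lemma tlin_keys:
  assumes "tlin N F" "Poly_Mapping.keys f \<subseteq> S" "\<And>l. l \<in> S \<Longrightarrow> length l = N"
    and "\<And>l. l \<in> S \<Longrightarrow> Poly_Mapping.keys (F (e l)) \<subseteq> S'"
  shows "Poly_Mapping.keys (F f) \<subseteq> S'"
proof -
  have "f \<in> tensor_space N"
    using assms(2,3) by (auto simp: tensor_space_iff)
  then show ?thesis
    unfolding tlin_apply[OF assms(1) \<open>f \<in> tensor_space N\<close>]
    using assms(2,4) by (intro keys_sum_subset keys_scale_subset) blast
qed

lemma tlin_id: "tlin N (\<lambda>f. f)"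
  by (simp add: tlin_def)

lemma tlin_comp: "tlin N F \<Longrightarrow> tlin N G \<Longrightarrow> tlin N (\<lambda>f. F (G f))"
  by (simp add: tlin_def)

lemma tlin_plus: "tlin N F \<Longrightarrow> tlin N G \<Longrightarrow> tlin N (\<lambda>f. F f + G f)"
  by (simp add: tlin_def vec.scale_right_distrib)

lemma tlin_minus: "tlin N F \<Longrightarrow> tlin N G \<Longrightarrow> tlin N (\<lambda>f. F f - G f)"
  by (simp add: tlin_def vec.scale_right_diff_distrib)

lemma tlin_scaled: "tlin N F \<Longrightarrow> tlin N (\<lambda>f. scale c (F f))"
  by (simp add: tlin_def vec.scale_right_distrib mult.commute)

lemma tlin_setsum:
  assumes "\<And>x. x \<in> A \<Longrightarrow> tlin N (F x)"
  shows "tlin N (\<lambda>f. \<Sum>x\<in>A. F x f)"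
  unfolding tlin_def
proof (intro conjI ballI allI)
  fix f g :: vec and c :: complex assume f: "f \<in> tensor_space N" and g: "g \<in> tensor_space N"
  show "(\<Sum>x\<in>A. F x f) \<in> tensor_space N"
    by (intro tensor_space_sum tlin_mem[OF assms f])
  show "(\<Sum>x\<in>A. F x (f + g)) = (\<Sum>x\<in>A. F x f) + (\<Sum>x\<in>A. F x g)"
    unfolding sum.distrib[symmetric] by (intro sum.cong refl tlin_add[OF assms f g])
  show "(\<Sum>x\<in>A. F x (scale c f)) = scale c (\<Sum>x\<in>A. F x f)"
    unfolding vec.scale_sum_right by (intro sum.cong refl tlin_scale[OF assms f])
qed

lemma linear_ext_superset:
  assumes "finite K" "Poly_Mapping.keys f \<subseteq> K"
  shows "linear_ext F f = (\<Sum>l\<in>K. scale (Poly_Mapping.lookup f l) (F l))"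
  unfolding linear_ext_def using assms by (intro sum.mono_neutral_left) (auto simp: in_keys_iff)

lemma linear_ext_zero [simp]: "linear_ext F 0 = 0"
  by (simp add: linear_ext_def)

lemma linear_ext_e [simp]: "linear_ext F (e l) = F l"
  by (simp add: linear_ext_def) (simp add: e_def)

lemma tlin_linear_ext:
  assumes "\<And>l. length l = N \<Longrightarrow> F l \<in> tensor_space N"
  shows "tlin N (linear_ext F)"
  unfolding tlin_def
proof (intro conjI ballI allI)
  fix f assume "f \<in> tensor_space N"
  then show "linear_ext F f \<in> tensor_space N"
    using assms unfolding linear_ext_def
    by (intro tensor_space_sum tensor_space_scale) (auto simp: tensor_space_def)
next
  fix f g :: vec
  let ?K = "Poly_Mapping.keys f \<union> Poly_Mapping.keys g"
  show "linear_ext F (f + g) = linear_ext F f + linear_ext F g"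
    using linear_ext_superset[of ?K f F] linear_ext_superset[of ?K g F]
      linear_ext_superset[of ?K "f + g" F] Poly_Mapping.keys_add[of f g]
    by (simp add: lookup_add vec.scale_left_distrib sum.distrib)
next
  fix c :: complex and f :: vec
  show "linear_ext F (scale c f) = scale c (linear_ext F f)"
    using linear_ext_superset[of "Poly_Mapping.keys f" f F]
      linear_ext_superset[of "Poly_Mapping.keys f" "scale c f" F] keys_scale[of c f]
    by (simp add: vec.scale_sum_right)
qed

lemma comps_Nil [simp]: "comps [] f = f"
  and comps_Cons [simp]: "comps (F # Fs) f = F (comps Fs f)"
  by (simp_all add: comps_def)

lemma comps_append [simp]: "comps (Fs @ Gs) f = comps Fs (comps Gs f)"
  by (induction Fs) simp_all

lemma tlin_comps: "(\<And>F. F \<in> set Fs \<Longrightarrow> tlin N F) \<Longrightarrow> tlin N (comps Fs)"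
proof (induction Fs)
  case Nil
  then show ?case by (simp add: tlin_def)
next
  case (Cons F Fs)
  have "tlin N (comps Fs)" "tlin N F" using Cons by simp_all
  then have "tlin N (\<lambda>f. F (comps Fs f))" by (rule tlin_comp[rotated])
  moreover have "comps (F # Fs) = (\<lambda>f. F (comps Fs f))" by (rule ext) simp
  ultimately show ?case by simp
qed

section \<open>The Hecke operators and their quadratic relation\<close>

abbreviation upd2 :: "weight \<Rightarrow> nat \<Rightarrow> int \<Rightarrow> int \<Rightarrow> weight" where
  "upd2 l i x y \<equiv> set_entry (set_entry l i x) (i + 1) y"

lemma length_set_entry [simp]: "length (set_entry l i x) = length l"
  by (simp add: set_entry_def)

lemma entry_set_entry [simp]: "1 \<le> i \<Longrightarrow> i \<le> length l \<Longrightarrow> entry (set_entry l i x) i = x"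
  by (simp add: entry_def set_entry_def)

lemma entry_set_entry_neq: "1 \<le> i \<Longrightarrow> 1 \<le> j \<Longrightarrow> i \<noteq> j \<Longrightarrow> entry (set_entry l i x) j = entry l j"
  by (simp add: entry_def set_entry_def)

lemma entry_set_entry_simps [simp]:
  "1 \<le> i \<Longrightarrow> entry (set_entry l i x) (Suc i) = entry l (Suc i)"
  "1 \<le> i \<Longrightarrow> entry (set_entry l (Suc i) x) i = entry l i"
  by (simp_all add: entry_set_entry_neq)

lemma set_entry_set_entry [simp]: "set_entry (set_entry l i x) i y = set_entry l i y"
  by (simp add: set_entry_def)

lemma set_entry_swap:
  "1 \<le> i \<Longrightarrow> set_entry (set_entry l (Suc i) y) i x = set_entry (set_entry l i x) (Suc i) y"
  by (simp add: set_entry_def list_update_swap)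

lemma upd2_upd2 [simp]:
  "1 \<le> i \<Longrightarrow> set_entry (set_entry (set_entry (set_entry l i x) (Suc i) y) i x') (Suc i) y' = upd2 l i x' y'"
  by (simp add: set_entry_swap)

lemma set_entry_entry [simp]: "set_entry l i (entry l i) = l"
  by (simp add: entry_def set_entry_def)

lemma tlin_Y_pow: "tlin N (Y_pow n i k)"
  and tlin_s_Y: "tlin N (s_Y n i)"
  and tlin_s_fac: "tlin N (s_fac i)"
  and tlin_E: "tlin N (E n i a b)"
  and tlin_kappa1: "tlin N kappa1"
  and tlin_D1: "tlin N (D1 n q u)"
  unfolding Y_pow_def s_Y_def s_fac_def E_def kappa1_def D1_def
  by (rule tlin_linear_ext; simp)+

lemma tlin_R: "tlin N (R n v i)"
proof -
  have EE: "tlin N (\<lambda>f. E n i a b (E n (i + 1) c d f))" for a b c d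
    by (rule tlin_comp[OF tlin_E tlin_E])
  have 1: "tlin N (\<lambda>f. scale v (\<Sum>a<n. E n i a a (E n (i + 1) a a f)))"
    by (rule tlin_scaled, rule tlin_setsum, rule EE)
  have 2: "tlin N (\<lambda>f. E n i a b (E n (i + 1) b a f) + E n i b a (E n (i + 1) a b f) +
        scale (v - inverse v) (E n i a a (E n (i + 1) b b f)))" for a b
    by (rule tlin_plus, rule tlin_plus, rule EE, rule EE, rule tlin_scaled, rule EE)
  have 3: "tlin N (\<lambda>f. \<Sum>b<n. \<Sum>a<b. E n i a b (E n (i + 1) b a f) +
        E n i b a (E n (i + 1) a b f) + scale (v - inverse v) (E n i a a (E n (i + 1) b b f)))"
    by (rule tlin_setsum, rule tlin_setsum, rule 2)
  show ?thesis
    unfolding R_def[abs_def] by (rule tlin_plus, rule 1, rule 3)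
qed

text \<open>By the quadratic relation this is the two-sided inverse of \<open>T\<close> on the
  tensor space; see \<open>T_Tinv\<close> and \<open>Tinv_T\<close>.\<close>

definition Tinv :: "nat \<Rightarrow> nat \<Rightarrow> complex \<Rightarrow> nat \<Rightarrow> oper" where
  "Tinv n N v i f = T n N v i f - scale (v - inverse v) f"

section \<open>Two neighbouring tensor factors: variables, residues and the R-matrix\<close>

locale adjacent =
  fixes n N i :: nat
  assumes n_pos: "n \<ge> 1" and i_pos: "1 \<le> i" and i_less: "i < N"
begin

text \<open>Multiplication by the quotient of the \<open>i\<close>-th by the next variable;
  \<open>div_diff\<close> solves \<open>Yq g - g = s_Y n i f - f\<close>.\<close>

definition Yq :: oper where "Yq f = Y_pow n i 1 (Y_pow n (i + 1) (-1) f)"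

definition Yqi :: oper where "Yqi f = Y_pow n i (-1) (Y_pow n (i + 1) 1 f)"

lemma tlin_Yq: "tlin N Yq" and tlin_Yqi: "tlin N Yqi"
  unfolding Yq_def[abs_def] Yqi_def[abs_def] by (rule tlin_comp[OF tlin_Y_pow tlin_Y_pow])+

lemma Yq_e: "length l = N \<Longrightarrow>
    Yq (e l) = e (upd2 l i (entry l i + int n) (entry l (i + 1) - int n))"
  and Yqi_e: "length l = N \<Longrightarrow>
    Yqi (e l) = e (upd2 l i (entry l i - int n) (entry l (i + 1) + int n))"
  using i_pos i_less by (simp_all add: Yq_def Yqi_def Y_pow_def set_entry_swap)

lemma s_Y_e: "s_Y n i (e l) =
    e (upd2 l i (int n * (entry l (i + 1) div int n) + entry l i mod int n)
      (int n * (entry l i div int n) + entry l (i + 1) mod int n))"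
  by (simp add: s_Y_def)

text \<open>On a basis vector each of the three families of matrix units in the triangular sum of
  \<open>R\<close> has at most one nonzero term; this extracts it.\<close>

lemma sum_triangle_delta:
  fixes F :: "nat \<Rightarrow> nat \<Rightarrow> vec"
  shows "(\<Sum>b<n. \<Sum>a<b. if a' = a \<and> b' = b then F a b else 0) =
    (if a' < b' \<and> b' < n then F a' b' else 0)"
proof -
  have "(\<Sum>a<b. if a' = a \<and> b' = b then F a b else 0) =
      (if b' = b then if a' < b' then F a' b' else 0 else 0)" for b
    by (cases "b' = b") simp_all
  then show ?thesis by simp
qed

text \<open>Replacing \<open>x\<close> by \<open>x - a + b\<close> changes the residue and keeps the
  exponent of the variable, so \<open>R\<close> exchanges residues only. The diagonal term for
  \<open>a < b\<close> comes from the products of diagonal matrix units.\<close>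

lemma R_e:
  assumes "length l = N"
  defines "a \<equiv> entry l i mod int n" and "b \<equiv> entry l (i + 1) mod int n"
  shows "R n v i (e l) = (if a = b then scale v (e l)
    else e (upd2 l i (entry l i - a + b) (entry l (i + 1) - b + a)) +
      (if a < b then scale (v - inverse v) (e l) else 0))"
proof -
  define x y where "x = entry l i" and "y = entry l (i + 1)"
  define a' b' where "a' = nat a" and "b' = nat b"
  have A: "a = int a'" "a' < n" and B: "b = int b'" "b' < n"
    using n_pos by (simp_all add: a'_def b'_def a_def b_def nat_less_iff)
  have xA: "x mod int n = int a'" and yB: "y mod int n = int b'"
    using A B by (simp_all add: x_def y_def a_def b_def)
  have l: "upd2 l i x y = l" using i_pos
    by (simp add: x_def y_def)
  have EE: "E n i c d (E n (i + 1) c' d' (e l)) =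
     (if a' = d \<and> b' = d' then e (upd2 l i (x - int a' + int c) (y - int b' + int c')) else 0)"
    for c d c' d'
    using assms(1) i_pos i_less xA yB
    by (simp add: E_def x_def y_def set_entry_swap)
  have 1: "(\<Sum>c<n. E n i c c (E n (i + 1) c c (e l))) = (if a' = b' then e l else 0)"
  proof -
    have "(\<Sum>c<n. E n i c c (E n (i + 1) c c (e l))) =
       (\<Sum>c<n. if a' = c then if a' = b' then e l else 0 else 0)"
      unfolding EE using l by (intro sum.cong) auto
    then show ?thesis using A by simp
  qed
  have 2: "(\<Sum>d<n. \<Sum>c<d.
        E n i c d (E n (i + 1) d c (e l)) +
        E n i d c (E n (i + 1) c d (e l)) +
        scale (v - inverse v) (E n i c c (E n (i + 1) d d (e l)))) =
      (\<Sum>d<n. \<Sum>c<d. if b' = c \<and> a' = d then e (upd2 l i (x - int d + int c) (y - int c + int d)) else 0) +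
      (\<Sum>d<n. \<Sum>c<d. if a' = c \<and> b' = d then e (upd2 l i (x - int c + int d) (y - int d + int c)) else 0) +
      (\<Sum>d<n. \<Sum>c<d. if a' = c \<and> b' = d then scale (v - inverse v) (e l) else 0)"
    unfolding EE sum.distrib[symmetric] using l by (intro sum.cong) auto
  show ?thesis
    unfolding R_def 1 2 sum_triangle_delta
    using A B by (auto simp: x_def y_def)
qed

lemma n_pos' [simp]: "int n > 0" "n \<noteq> 0" "n > 0"
  using n_pos by auto

lemma i_simps [simp]: "Suc 0 \<le> i" "i \<le> N" "Suc i \<le> N" "i \<noteq> 0"
  using i_pos i_less by auto

lemma div_mod_add_mult [simp]:
  "(x + int n) div int n = x div int n + 1" "(x + int n) mod int n = x mod int n"
  "(x - int n) div int n = x div int n - 1" "(x - int n) mod int n = x mod int n"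
  "(int n * k + y mod int n) div int n = k" "(int n * k + y mod int n) mod int n = y mod int n"
  "(x - x mod int n + y mod int n) div int n = x div int n"
  "(x - x mod int n + y mod int n) mod int n = y mod int n"
proof -
  show "(x - int n) div int n = x div int n - 1" "(x - int n) mod int n = x mod int n"
    using div_mult_self1[of "int n" x "-1"] mod_mult_self1[of x "-1" "int n"] by simp_all
  have "x - x mod int n + y mod int n = int n * (x div int n) + y mod int n"
    by (simp add: minus_mod_eq_mult_div)
  then show "(x - x mod int n + y mod int n) div int n = x div int n"
    "(x - x mod int n + y mod int n) mod int n = y mod int n"
    by simp_all
qed simp_all

lemma upd2_same [simp]: "set_entry (set_entry l i (entry l i)) (Suc i) (entry l (Suc i)) = l"
  by simp

section \<open>Relations between the exchange of variables, their quotient and the R-matrix\<close>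

lemma s_Y_s_Y: "f \<in> tensor_space N \<Longrightarrow> s_Y n i (s_Y n i f) = f"
  by (rule tlin_eqI[OF tlin_comp[OF tlin_s_Y tlin_s_Y] tlin_id]) (simp_all add: s_Y_e)

lemma Yqi_Yq: "f \<in> tensor_space N \<Longrightarrow> Yqi (Yq f) = f"
  by (rule tlin_eqI[OF tlin_comp[OF tlin_Yqi tlin_Yq] tlin_id]) (simp_all add: Yq_e Yqi_e)

lemma Yq_s_Y: "f \<in> tensor_space N \<Longrightarrow> Yq (s_Y n i f) = s_Y n i (Yqi f)"
  by (rule tlin_eqI[OF tlin_comp[OF tlin_Yq tlin_s_Y] tlin_comp[OF tlin_s_Y tlin_Yqi]])
    (simp_all add: Yq_e Yqi_e s_Y_e algebra_simps)

text \<open>\<open>R\<close> acts on the residues and \<open>s_Y\<close> on the exponents, so they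
  commute; the same reason gives \<open>R_Yq\<close>.\<close>

lemma R_s_Y: "f \<in> tensor_space N \<Longrightarrow> R n v i (s_Y n i f) = s_Y n i (R n v i f)"
  by (rule tlin_eqI[OF tlin_comp[OF tlin_R tlin_s_Y] tlin_comp[OF tlin_s_Y tlin_R]])
    (auto simp: R_e s_Y_e tlin_add[OF tlin_s_Y[of N]] tlin_scale[OF tlin_s_Y[of N]]
      tlin_zero[OF tlin_s_Y[of N]])

lemma R_Yq: "f \<in> tensor_space N \<Longrightarrow> R n v i (Yq f) = Yq (R n v i f)"
proof (rule tlin_eqI[OF tlin_comp[OF tlin_R tlin_Yq] tlin_comp[OF tlin_Yq tlin_R]])
  fix l :: weight assume "length l = N"
  have "x + int n - a + b = x - a + b + int n" "x - int n - a + b = x - a + b - int n"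
    for x a b
    by simp_all
  note shift = this
  from \<open>length l = N\<close> show "R n v i (Yq (e l)) = Yq (R n v i (e l))"
    by (auto simp: R_e Yq_e tlin_add[OF tlin_Yq] tlin_scale[OF tlin_Yq] tlin_zero[OF tlin_Yq] shift)
qed

text \<open>On equal residues this is v^2 = (v - v^{-1}) v + 1. On a pair of distinct residues
  \<open>R\<close> is a 2 by 2 block with trace v - v^{-1} and determinant -1.\<close>

lemma R_R:
  assumes "v \<noteq> 0" "f \<in> tensor_space N"
  shows "R n v i (R n v i f) = scale (v - inverse v) (R n v i f) + f"
proof (rule tlin_eqI[OF tlin_comp[OF tlin_R tlin_R] tlin_plus[OF tlin_scaled[OF tlin_R] tlin_id] _ assms(2)])
  fix l :: weight assume l: "length l = N"
  have "scale (v * v) (e l) = scale ((v - inverse v) * v) (e l) + e l"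
    using assms(1) by (simp add: algebra_simps vec.scale_left_diff_distrib)
  with l show "R n v i (R n v i (e l)) = scale (v - inverse v) (R n v i (e l)) + e l"
    by (auto simp: R_e tlin_add[OF tlin_R[of N]] tlin_scale[OF tlin_R[of N]]
        tlin_zero[OF tlin_R[of N]] vec.scale_right_distrib)
qed

section \<open>The divided difference in closed form\<close>

lemma Yq_minus_id_inj:
  assumes g: "g \<in> tensor_space N" and "Yq g = g"
  shows "g = 0"
proof (rule ccontr)
  assume "g \<noteq> 0"
  then have ne: "(\<lambda>l. entry l i) ` Poly_Mapping.keys g \<noteq> {}" by simp
  \<comment> \<open>A finite support has a largest \<open>i\<close>-th entry \<open>k\<close>. A
    vector fixed by \<open>Yq\<close> is also fixed by \<open>Yqi\<close>, which lowers every
    \<open>i\<close>-th entry by \<open>n\<close>, so \<open>k\<close> could not occur.\<close>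
  define k where "k = Max ((\<lambda>l. entry l i) ` Poly_Mapping.keys g)"
  have "k \<in> (\<lambda>l. entry l i) ` Poly_Mapping.keys g"
    unfolding k_def using ne by (intro Max_in) auto
  then obtain l where l: "l \<in> Poly_Mapping.keys g" "entry l i = k" by auto
  have "Poly_Mapping.keys (Yqi g) \<subseteq> {l. entry l i \<le> k - int n}"
  proof (rule tlin_keys[OF tlin_Yqi])
    show "Poly_Mapping.keys g \<subseteq> {l. length l = N \<and> entry l i \<le> k}"
      using g by (auto simp: tensor_space_def k_def)
  qed (auto simp: Yqi_e)
  moreover have "Yqi g = g" using Yqi_Yq[OF g] assms(2) by simp
  ultimately show False using l by auto
qed

text \<open>Identities for \<open>Delta\<close> are proved by applying \<open>Yq - 1\<close> to both
  sides, which by \<open>Yq_Delta\<close> turns them into identities for \<open>s_Y\<close>.\<close>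

lemma Yq_minus_id_cancel:
  assumes "f \<in> tensor_space N" "g \<in> tensor_space N" "Yq f - f = Yq g - g"
  shows "f = g"
  using Yq_minus_id_inj[of "f - g"] assms tlin_diff[OF tlin_Yq, of f g]
  by (simp add: algebra_simps)

text \<open>Exchanging the variables multiplies \<open>e l\<close> by the \<open>m\<close>-th power
  of \<open>Yq\<close>, so the quotient is the geometric sum (Yq^m - 1) / (Yq - 1) applied to
  \<open>e l\<close>; for negative \<open>m\<close> it is minus the sum of the powers from
  \<open>m\<close> to -1.\<close>

definition Delta_e :: "weight \<Rightarrow> vec" where
  "Delta_e l = (let x = entry l i; y = entry l (i + 1); m = y div int n - x div int n in
     if m \<ge> 0 then (\<Sum>t<nat m. e (upd2 l i (x + int n * int t) (y - int n * int t)))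
     else - (\<Sum>t<nat (- m). e (upd2 l i (x + int n * m + int n * int t) (y - int n * m - int n * int t))))"

definition Delta :: oper where "Delta = linear_ext Delta_e"

lemma Delta_e_mem: "length l = N \<Longrightarrow> Delta_e l \<in> tensor_space N"
  using tensor_space_diff[of 0 N] by (auto simp: Delta_e_def Let_def)

lemma tlin_Delta: "tlin N Delta"
  unfolding Delta_def by (rule tlin_linear_ext) (rule Delta_e_mem)

lemma Yq_telescope:
  assumes "length l = N"
  shows "Yq (\<Sum>t<k. e (upd2 l i (x + int n * int t) (y - int n * int t))) -
      (\<Sum>t<k. e (upd2 l i (x + int n * int t) (y - int n * int t))) =
    e (upd2 l i (x + int n * int k) (y - int n * int k)) - e (upd2 l i x y)"
proof -
  let ?g = "\<lambda>t. e (upd2 l i (x + int n * int t) (y - int n * int t))"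
  have "Yq (\<Sum>t<k. ?g t) = (\<Sum>t<k. ?g (Suc t))"
    using assms by (subst tlin_sum[OF tlin_Yq]) (auto simp: Yq_e algebra_simps)
  then show ?thesis
    using sum_lessThan_telescope[of ?g k] by (simp add: sum_subtractf)
qed

lemma Yq_Delta:
  assumes "f \<in> tensor_space N"
  shows "Yq (Delta f) - Delta f = s_Y n i f - f"
proof (rule tlin_eqI[OF tlin_minus[OF tlin_comp[OF tlin_Yq tlin_Delta] tlin_Delta]
      tlin_minus[OF tlin_s_Y tlin_id] _ assms])
  fix l :: weight assume l: "length l = N"
  define x y where "x = entry l i" and "y = entry l (i + 1)"
  define m where "m = y div int n - x div int n"
  have x': "int n * (y div int n) + x mod int n = x + int n * m"
    and y': "int n * (x div int n) + y mod int n = y - int n * m"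
    using mult_div_mod_eq[of "int n" x] mult_div_mod_eq[of "int n" y]
    unfolding m_def right_diff_distrib by linarith+
  have s: "s_Y n i (e l) = e (upd2 l i (x + int n * m) (y - int n * m))"
    using x' y' by (simp add: s_Y_e x_def y_def)
  have l_eq: "upd2 l i x y = l" by (simp add: x_def y_def)
  show "Yq (Delta (e l)) - Delta (e l) = s_Y n i (e l) - e l"
  proof (cases "m \<ge> 0")
    case True
    then have "Delta (e l) = (\<Sum>t<nat m. e (upd2 l i (x + int n * int t) (y - int n * int t)))"
      by (simp add: Delta_def Delta_e_def Let_def x_def y_def m_def)
    moreover have "int (nat m) = m" using True by simp
    ultimately show ?thesis
      using Yq_telescope[OF l, of x y "nat m"] unfolding s l_eq by simp
  next
    case False
    let ?S = "\<Sum>t<nat (- m). e (upd2 l i (x + int n * m + int n * int t) (y - int n * m - int n * int t))"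
    \<comment> \<open>Written as a difference so that \<open>tlin_diff\<close> applies.\<close>
    have D: "Delta (e l) = 0 - ?S"
      using False by (simp add: Delta_def Delta_e_def Let_def x_def y_def m_def)
    have "int (nat (- m)) = - m" using False by simp
    then have ends: "x + int n * m + int n * int (nat (- m)) = x" "y - int n * m - int n * int (nat (- m)) = y"
      by simp_all
    have S: "Yq ?S - ?S = e l - s_Y n i (e l)"
      using Yq_telescope[OF l, of "x + int n * m" "y - int n * m" "nat (- m)"]
      unfolding ends s l_eq .
    have "Yq (0 - ?S) = 0 - Yq ?S"
      using l by (subst tlin_diff[OF tlin_Yq]) (auto simp: tlin_zero[OF tlin_Yq])
    then have "Yq (Delta (e l)) - Delta (e l) = - (Yq ?S - ?S)"
      unfolding D by simp
    then show ?thesis unfolding S by simp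
  qed
qed

text \<open>Existence of the quotient is \<open>Yq_Delta\<close>, uniqueness is
  \<open>Yq_minus_id_cancel\<close>.\<close>

lemma div_diff_eq:
  assumes "f \<in> tensor_space N"
  shows "div_diff n N i f = Delta f"
  unfolding div_diff_def
proof (rule the_equality)
  show "Delta f \<in> tensor_space N \<and>
      Y_pow n i 1 (Y_pow n (i + 1) (- 1) (Delta f)) - Delta f = s_Y n i f - f"
    using Yq_Delta[OF assms, unfolded Yq_def] tlin_mem[OF tlin_Delta assms] by (rule conjI[rotated])
  fix g assume "g \<in> tensor_space N \<and>
      Y_pow n i 1 (Y_pow n (i + 1) (- 1) g) - g = s_Y n i f - f"
  then have g: "g \<in> tensor_space N" "Yq g - g = Yq (Delta f) - Delta f"
    unfolding Yq_Delta[OF assms] unfolding Yq_def by blast+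
  show "g = Delta f"
    by (rule Yq_minus_id_cancel[OF g(1) tlin_mem[OF tlin_Delta assms] g(2)])
qed

lemma Delta_s_Y:
  assumes f: "f \<in> tensor_space N"
  shows "Delta (s_Y n i f) = - Delta f"
proof -
  have s: "s_Y n i f \<in> tensor_space N" by (rule tlin_mem[OF tlin_s_Y f])
  have D: "Delta f \<in> tensor_space N" "Delta (s_Y n i f) \<in> tensor_space N"
    by (rule tlin_mem[OF tlin_Delta f] tlin_mem[OF tlin_Delta s])+
  have "Delta (s_Y n i f) = 0 - Delta f"
  proof (rule Yq_minus_id_cancel)
    have "Yq (0 - Delta f) = 0 - Yq (Delta f)"
      using D by (subst tlin_diff[OF tlin_Yq]) (auto simp: tlin_zero[OF tlin_Yq])
    then have "Yq (0 - Delta f) - (0 - Delta f) = - (Yq (Delta f) - Delta f)" by simp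
    then show "Yq (Delta (s_Y n i f)) - Delta (s_Y n i f) = Yq (0 - Delta f) - (0 - Delta f)"
      unfolding Yq_Delta[OF s] Yq_Delta[OF f] s_Y_s_Y[OF f] by simp
  qed (use D in auto)
  then show ?thesis by simp
qed

text \<open>Conjugation by \<open>s_Y\<close> inverts \<open>Yq\<close>. Formally \<open>s_Y\<close>
  sends (s f - f) / (Yq - 1) to (f - s f) / (Yq^{-1} - 1), which is \<open>Yq (Delta f)\<close>, and
  this equals the right-hand side by \<open>Yq_Delta\<close>.\<close>

lemma s_Y_Delta:
  assumes f: "f \<in> tensor_space N"
  shows "s_Y n i (Delta f) = Delta f + s_Y n i f - f"
proof (rule Yq_minus_id_cancel)
  have s: "s_Y n i f \<in> tensor_space N" by (rule tlin_mem[OF tlin_s_Y f])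
  have D: "Delta f \<in> tensor_space N" by (rule tlin_mem[OF tlin_Delta f])
  have Yf: "Yqi f \<in> tensor_space N" "Yq f \<in> tensor_space N" by (rule tlin_mem[OF tlin_Yqi f] tlin_mem[OF tlin_Yq f])+
  have YD: "Yqi (Delta f) \<in> tensor_space N" by (rule tlin_mem[OF tlin_Yqi D])
  show "s_Y n i (Delta f) \<in> tensor_space N" by (rule tlin_mem[OF tlin_s_Y D])
  show "Delta f + s_Y n i f - f \<in> tensor_space N" using s D f by simp
  have "Yqi (Delta f) - Delta f = - Yqi (Yq (Delta f) - Delta f)"
    using D Yqi_Yq[OF D] by (subst tlin_diff[OF tlin_Yqi]) (auto intro: tlin_mem[OF tlin_Yq])
  also have "\<dots> = Yqi f - Yqi (s_Y n i f)"
    unfolding Yq_Delta[OF f] using s f by (subst tlin_diff[OF tlin_Yqi]) auto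
  finally have *: "Yqi (Delta f) - Delta f = Yqi f - Yqi (s_Y n i f)" .
  have "Yq (s_Y n i (Delta f)) - s_Y n i (Delta f) = s_Y n i (Yqi (Delta f) - Delta f)"
    unfolding Yq_s_Y[OF D] using D YD by (subst tlin_diff[OF tlin_s_Y[of N]]) auto
  also have "\<dots> = s_Y n i (Yqi f) - s_Y n i (Yqi (s_Y n i f))"
    unfolding * using Yf s by (subst tlin_diff[OF tlin_s_Y[of N]]) (auto intro: tlin_mem[OF tlin_Yqi])
  also have "\<dots> = Yq (s_Y n i f) - Yq f"
    by (simp add: Yq_s_Y[symmetric] f s s_Y_s_Y)
  also have "\<dots> = Yq (Delta f + s_Y n i f - f) - (Delta f + s_Y n i f - f)"
    using Yq_Delta[OF f] f s D
    by (simp add: tlin_diff[OF tlin_Yq] tlin_add[OF tlin_Yq] algebra_simps)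
  finally show "Yq (s_Y n i (Delta f)) - s_Y n i (Delta f) =
      Yq (Delta f + s_Y n i f - f) - (Delta f + s_Y n i f - f)" .
qed

text \<open>By \<open>s_Y_Delta\<close>, applying \<open>s_Y - 1\<close> to \<open>Delta f\<close>
  and to \<open>f\<close> gives the same vector, hence the same quotient.\<close>

lemma Delta_Delta:
  assumes f: "f \<in> tensor_space N"
  shows "Delta (Delta f) = Delta f"
proof (rule Yq_minus_id_cancel)
  have D: "Delta f \<in> tensor_space N" by (rule tlin_mem[OF tlin_Delta f])
  then show "Delta f \<in> tensor_space N" "Delta (Delta f) \<in> tensor_space N"
    by (auto intro: tlin_mem[OF tlin_Delta])
  show "Yq (Delta (Delta f)) - Delta (Delta f) = Yq (Delta f) - Delta f"
    unfolding Yq_Delta[OF f] Yq_Delta[OF D] by (simp add: s_Y_Delta[OF f])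
qed

text \<open>\<open>R\<close> commutes with numerator and denominator of the quotient, by
  \<open>R_s_Y\<close> and \<open>R_Yq\<close>.\<close>

lemma R_Delta:
  assumes f: "f \<in> tensor_space N"
  shows "R n v i (Delta f) = Delta (R n v i f)"
proof (rule Yq_minus_id_cancel)
  have D: "Delta f \<in> tensor_space N" by (rule tlin_mem[OF tlin_Delta f])
  have Rf: "R n v i f \<in> tensor_space N" by (rule tlin_mem[OF tlin_R f])
  have sf: "s_Y n i f \<in> tensor_space N" by (rule tlin_mem[OF tlin_s_Y f])
  have YD: "Yq (Delta f) \<in> tensor_space N" by (rule tlin_mem[OF tlin_Yq D])
  show "R n v i (Delta f) \<in> tensor_space N" by (rule tlin_mem[OF tlin_R D])
  show "Delta (R n v i f) \<in> tensor_space N" by (rule tlin_mem[OF tlin_Delta Rf])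
  have "Yq (R n v i (Delta f)) - R n v i (Delta f) = R n v i (Yq (Delta f) - Delta f)"
    using D YD by (simp add: tlin_diff[OF tlin_R[of N]] R_Yq)
  also have "\<dots> = Yq (Delta (R n v i f)) - Delta (R n v i f)"
    unfolding Yq_Delta[OF f] Yq_Delta[OF Rf] using f sf
    by (simp add: tlin_diff[OF tlin_R[of N]] R_s_Y)
  finally show "Yq (R n v i (Delta f)) - R n v i (Delta f) =
      Yq (Delta (R n v i f)) - Delta (R n v i f)" .
qed

section \<open>The Hecke generators and their quadratic relation\<close>

lemma T_eq:
  "f \<in> tensor_space N \<Longrightarrow> T n N v i f = s_Y n i (R n v i f) + scale (v - inverse v) (Delta f)"
  by (simp add: T_def div_diff_eq)

lemma tlin_T: "tlin N (T n N v i)"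
proof -
  have "tlin N (\<lambda>f. s_Y n i (R n v i f) + scale (v - inverse v) (Delta f))"
    by (rule tlin_plus[OF tlin_comp[OF tlin_s_Y tlin_R] tlin_scaled[OF tlin_Delta]])
  then show ?thesis
    unfolding tlin_def by (simp add: T_eq)
qed

text \<open>With h = v - v^{-1} and T = s R + h Delta, squaring gives R^2 + h (s Delta R - Delta R)
  + h^2 Delta. Here R^2 = h R + 1 and s Delta R = Delta R + s R - R, so the terms h R and h Delta R
  cancel.\<close>

lemma T_quadratic:
  assumes "v \<noteq> 0" and f: "f \<in> tensor_space N"
  shows "T n N v i (T n N v i f) = scale (v - inverse v) (T n N v i f) + f"
proof -
  define h where "h = v - inverse v"
  let ?s = "s_Y n i" and ?R = "R n v i"
  have Rf: "?R f \<in> tensor_space N" by (rule tlin_mem[OF tlin_R f])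
  have Df: "Delta f \<in> tensor_space N" by (rule tlin_mem[OF tlin_Delta f])
  have sRf: "?s (?R f) \<in> tensor_space N" by (rule tlin_mem[OF tlin_s_Y Rf])
  have RRf: "?R (?R f) \<in> tensor_space N" by (rule tlin_mem[OF tlin_R Rf])
  have DRf: "Delta (?R f) \<in> tensor_space N" by (rule tlin_mem[OF tlin_Delta Rf])
  have "T n N v i (T n N v i f) =
      ?s (?R (?s (?R f) + scale h (Delta f))) + scale h (Delta (?s (?R f) + scale h (Delta f)))"
    using f sRf Df by (simp add: T_eq h_def)
  also have "?s (?R (?s (?R f) + scale h (Delta f))) = ?R (?R f) + scale h (?s (Delta (?R f)))"
    using f Rf Df sRf RRf DRf
    by (simp add: tlin_add[OF tlin_R[of N]] tlin_scale[OF tlin_R[of N]] R_s_Y R_Delta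
        tlin_add[OF tlin_s_Y[of N]] tlin_scale[OF tlin_s_Y[of N]] s_Y_s_Y tlin_mem[OF tlin_s_Y])
  also have "Delta (?s (?R f) + scale h (Delta f)) = - Delta (?R f) + scale h (Delta f)"
    using f Rf Df sRf
    by (simp add: tlin_add[OF tlin_Delta] tlin_scale[OF tlin_Delta] Delta_s_Y Delta_Delta)
  finally show ?thesis
    unfolding R_R[OF assms] s_Y_Delta[OF Rf] T_eq[OF f, of v] h_def[symmetric]
    by (simp add: vec.scale_right_distrib vec.scale_right_diff_distrib)
qed

section \<open>Supports of the Hecke generators and their inverses on basis vectors\<close>

lemma s_Y_R_e:
  assumes "length l = N"
  defines "x \<equiv> entry l i" and "y \<equiv> entry l (i + 1)"
  defines "m \<equiv> y div int n - x div int n"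
  shows "s_Y n i (R n v i (e l)) = (if x mod int n = y mod int n then scale v (e (upd2 l i y x))
    else e (upd2 l i y x) +
      (if x mod int n < y mod int n then scale (v - inverse v) (e (upd2 l i (x + int n * m) (y - int n * m)))
       else 0))"
proof -
  have x': "int n * (y div int n) + x mod int n = x + int n * m"
    and y': "int n * (x div int n) + y mod int n = y - int n * m"
    using mult_div_mod_eq[of "int n" x] mult_div_mod_eq[of "int n" y]
    unfolding m_def right_diff_distrib by linarith+
  have s: "s_Y n i (e l) = e (upd2 l i (x + int n * m) (y - int n * m))"
    using x' y' by (simp add: s_Y_e x_def y_def)
  \<comment> \<open>\<open>R\<close> has exchanged the residues and \<open>s_Y\<close> now exchanges
    the exponents: together the whole entries are exchanged.\<close>
  have s2: "s_Y n i (e (upd2 l i (x - x mod int n + y mod int n) (y - y mod int n + x mod int n))) =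
      e (upd2 l i y x)"
    using assms(1) by (simp add: s_Y_e)
  note R = R_e[OF assms(1), of v, folded x_def y_def]
  show ?thesis
  proof (cases "x mod int n = y mod int n")
    case True
    then have ends: "x + int n * m = y" "y - int n * m = x"
      using x' y' mult_div_mod_eq[of "int n" x] mult_div_mod_eq[of "int n" y] by linarith+
    have "s_Y n i (R n v i (e l)) = scale v (s_Y n i (e l))"
      unfolding R if_P[OF True] by (rule tlin_scale[OF tlin_s_Y]) (use assms(1) in simp)
    then show ?thesis unfolding s ends if_P[OF True] .
  next
    case False
    let ?l = "upd2 l i (x - x mod int n + y mod int n) (y - y mod int n + x mod int n)"
    let ?r = "\<lambda>f. if x mod int n < y mod int n then scale (v - inverse v) f else 0"
    have "s_Y n i (e ?l + ?r (e l)) = s_Y n i (e ?l) + s_Y n i (?r (e l))"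
      by (rule tlin_add[OF tlin_s_Y]) (use assms(1) in \<open>simp, auto intro: tensor_space_scale\<close>)
    also have "s_Y n i (?r (e l)) = ?r (s_Y n i (e l))"
      using assms(1) by (simp add: tlin_scale[OF tlin_s_Y[of N]] tlin_zero[OF tlin_s_Y[of N]])
    finally show ?thesis unfolding R if_not_P[OF False] s s2 .
  qed
qed

text \<open>The last summand is supported on weights whose entries \<open>i, i + 1\<close> lie strictly between those
  of \<open>l\<close>; for \<open>x < y\<close> they are even moved by at least \<open>n\<close>, which is what survives
  the shift of the first entry in \<open>X\<^sub>1\<^sup>-\<^sup>1\<close>.\<close>

lemma T_e:
  assumes "length l = N"
  defines "x \<equiv> entry l i" and "y \<equiv> entry l (i + 1)"
  shows "\<exists>c w. T n N v i (e l) = scale c (e (upd2 l i y x)) +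
      (if x < y then scale (v - inverse v) (e l) else 0) + w \<and>
    Poly_Mapping.keys w \<subseteq> {upd2 l i z (x + y - z) | z.
      if x < y then x + int n \<le> z \<and> z < y else y < z \<and> z < x}"
proof -
  define m where "m = y div int n - x div int n"
  define a b where "a = x mod int n" and "b = y mod int n"
  define h where "h = v - inverse v"
  define g where "g z = e (upd2 l i z (x + y - z))" for z
  let ?S = "{upd2 l i z (x + y - z) | z. if x < y then x + int n \<le> z \<and> z < y else y < z \<and> z < x}"
  have ab: "0 \<le> a" "a < int n" "0 \<le> b" "b < int n" by (simp_all add: a_def b_def)
  have y_eq: "y = x + int n * m + b - a"
    using mult_div_mod_eq[of "int n" x] mult_div_mod_eq[of "int n" y]
    unfolding m_def a_def b_def right_diff_distrib by linarith
  have g_keys_less: "Poly_Mapping.keys (g z) \<subseteq> ?S" if "x < y" "x + int n \<le> z" "z < y" for z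
    using that unfolding g_def by auto
  have g_keys_greater: "Poly_Mapping.keys (g z) \<subseteq> ?S" if "y < x" "y < z" "z < x" for z
    using that unfolding g_def by auto
  have gx: "g x = e l" by (simp add: g_def x_def y_def)
  have gy: "e (upd2 l i y x) = g y" by (simp add: g_def)
  have gm: "e (upd2 l i (x + int n * m) (y - int n * m)) = g (x + int n * m)"
    by (simp add: g_def)
  have sR: "s_Y n i (R n v i (e l)) = (if a = b then scale v (g y)
      else g y + (if a < b then scale h (g (x + int n * m)) else 0))"
    using s_Y_R_e[OF assms(1), of v] unfolding x_def[symmetric] y_def[symmetric] m_def[symmetric]
      a_def[symmetric] b_def[symmetric] gy gm h_def .
  have T: "T n N v i (e l) = s_Y n i (R n v i (e l)) + scale h (Delta (e l))"
    using assms(1) by (simp add: T_eq h_def)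
  consider "m = 0" | "m > 0" | "m < 0" by linarith
  then show ?thesis
  proof cases
    case 1
    then have "Delta (e l) = 0"
      by (simp add: Delta_def Delta_e_def Let_def m_def x_def y_def)
    \<comment> \<open>For equal exponents the conditions \<open>a < b\<close> and
      \<open>x < y\<close> coincide, so the diagonal part of \<open>R\<close> supplies the term at
      \<open>e l\<close>.\<close>
    moreover have "x + int n * m = x" "y = x + b - a" using 1 y_eq by simp_all
    ultimately have "T n N v i (e l) = scale (if a = b then v else 1) (g y) +
        (if x < y then scale h (e l) else 0) + 0"
      unfolding T sR by (simp add: gx)
    then show ?thesis unfolding gy h_def[symmetric] by fastforce
  next
    case 2
    \<comment> \<open>The first term of the geometric sum is \<open>e l\<close> and gives the
      diagonal term of the claim; the other \<open>M\<close> terms lie strictly between.\<close>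
    define M where "M = nat m - 1"
    have M: "nat m = Suc M" "int M + 1 = m" using 2 by (simp_all add: M_def)
    have lt: "x + int n * (m - 1) < y" using y_eq ab unfolding right_diff_distrib by simp
    have le: "x \<le> x + int n * (m - 1)" using 2 by simp
    have xy: "x < y" using lt le by simp
    have D: "Delta (e l) = e l + (\<Sum>t<M. g (x + int n * int (Suc t)))"
    proof -
      have "Delta (e l) = (\<Sum>t<nat m. g (x + int n * int t))"
        using 2 by (simp add: Delta_def Delta_e_def Let_def m_def x_def y_def g_def diff_diff_eq add.assoc)
      then show ?thesis unfolding M sum.lessThan_Suc_shift by (simp add: gx)
    qed
    have step: "Poly_Mapping.keys (g (x + int n * int (Suc t))) \<subseteq> ?S" if "t < M" for t
    proof (rule g_keys_less[OF xy])
      have "int n * int (Suc t) \<le> int n * (m - 1)" "int n * 1 \<le> int n * int (Suc t)"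
        using that M by (intro mult_left_mono; simp)+
      then show "x + int n \<le> x + int n * int (Suc t)" "x + int n * int (Suc t) < y"
        using lt by linarith+
    qed
    have top: "Poly_Mapping.keys (g (x + int n * m)) \<subseteq> ?S" if "a < b"
    proof (rule g_keys_less[OF xy])
      have "int n * 1 \<le> int n * m" using 2 by (intro mult_left_mono) auto
      then show "x + int n \<le> x + int n * m" "x + int n * m < y"
        using that y_eq by linarith+
    qed
    let ?w = "(if a < b then scale h (g (x + int n * m)) else 0) +
      scale h (\<Sum>t<M. g (x + int n * int (Suc t)))"
    have "T n N v i (e l) = scale (if a = b then v else 1) (g y) + scale h (e l) + ?w"
      unfolding T sR D by (simp add: vec.scale_right_distrib)
    moreover have "Poly_Mapping.keys ?w \<subseteq> ?S"
      using step top
      by (intro keys_add_subset keys_scale_subset keys_sum_subset) (auto simp: keys_scale_subset)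
    ultimately show ?thesis unfolding gy h_def[symmetric] using xy
      by (intro exI conjI) (assumption | simp)+
  next
    case 3
    define M where "M = nat (- m) - 1"
    have M: "nat (- m) = Suc M" "int M + 1 = - m" using 3 by (simp_all add: M_def)
    have gt: "y < x + int n * (m + 1)" using y_eq ab unfolding distrib_left by simp
    have le: "x + int n * (m + 1) \<le> x" using 3 by (simp add: mult_nonneg_nonpos)
    have xy: "y < x" using gt le by simp
    have D: "Delta (e l) = - g (x + int n * m) - (\<Sum>t<M. g (x + int n * m + int n * int (Suc t)))"
    proof -
      have "Delta (e l) = - (\<Sum>t<nat (- m). g (x + int n * m + int n * int t))"
        using 3 by (simp add: Delta_def Delta_e_def Let_def m_def x_def y_def g_def diff_diff_eq add.assoc)
      then show ?thesis unfolding M sum.lessThan_Suc_shift by simp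
    qed
    have step: "Poly_Mapping.keys (g (x + int n * m + int n * int (Suc t))) \<subseteq> ?S" if "t < M" for t
    proof (rule g_keys_greater[OF xy])
      have "int n * (m + 1) \<le> int n * (m + int (Suc t))" "int n * (m + int (Suc t)) < int n * 0"
        using that M by (intro mult_left_mono mult_strict_left_mono; simp)+
      then show "y < x + int n * m + int n * int (Suc t)" "x + int n * m + int n * int (Suc t) < x"
        using gt unfolding distrib_left by linarith+
    qed
    have bot: "Poly_Mapping.keys (g (x + int n * m)) \<subseteq> ?S" if "b < a"
    proof (rule g_keys_greater[OF xy])
      have "int n * m < 0" using 3 by (simp add: mult_pos_neg)
      then show "y < x + int n * m" "x + int n * m < x"
        using that y_eq by linarith+
    qed
    \<comment> \<open>The end term \<open>g (x + int n * m)\<close> has coefficient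
      \<open>- h\<close> in the divided difference. For \<open>a < b\<close> it cancels against the
      term from \<open>R\<close>; for \<open>a = b\<close> it equals \<open>g y\<close> and changes
      the coefficient \<open>v\<close> to \<open>v - h\<close>; it survives only for
      \<open>b < a\<close>.\<close>
    let ?w = "(if b < a then scale (- h) (g (x + int n * m)) else 0) +
      scale (- h) (\<Sum>t<M. g (x + int n * m + int n * int (Suc t)))"
    have "T n N v i (e l) = scale (if a = b then v - h else 1) (g y) + ?w"
    proof -
      have "scale v (g y) - scale h (g (x + int n * m)) = scale (v - h) (g y)" if "a = b"
        using that y_eq by (simp add: vec.scale_left_diff_distrib)
      then show ?thesis
        unfolding T sR D by (auto simp: vec.scale_right_diff_distrib)
    qed
    moreover have "Poly_Mapping.keys ?w \<subseteq> ?S"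
      using step bot
      by (intro keys_add_subset keys_scale_subset keys_sum_subset) (auto simp: keys_scale_subset)
    ultimately show ?thesis unfolding gy h_def[symmetric] using xy
      by (intro exI conjI) (assumption | simp)+
  qed
qed

lemma tlin_Tinv: "tlin N (Tinv n N v i)"
  unfolding Tinv_def[abs_def] by (rule tlin_minus[OF tlin_T tlin_scaled[OF tlin_id]])

lemma T_Tinv:
  assumes "v \<noteq> 0" "f \<in> tensor_space N"
  shows "T n N v i (Tinv n N v i f) = f"
  unfolding Tinv_def
  using assms tlin_mem[OF tlin_T assms(2), of v] T_quadratic[OF assms]
  by (simp add: tlin_diff[OF tlin_T] tlin_scale[OF tlin_T])

lemma Tinv_T:
  assumes "v \<noteq> 0" "f \<in> tensor_space N"
  shows "Tinv n N v i (T n N v i f) = f"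
  unfolding Tinv_def T_quadratic[OF assms] by simp

lemma keys_T:
  assumes "length l = N" "m \<in> Poly_Mapping.keys (T n N v i (e l))"
  defines "x \<equiv> entry l i" and "y \<equiv> entry l (i + 1)"
  shows "m = upd2 l i y x \<or> x < y \<and> m = l \<or>
    (\<exists>z. m = upd2 l i z (x + y - z) \<and> min x y < z \<and> z < max x y)"
proof -
  obtain c w where T: "T n N v i (e l) = scale c (e (upd2 l i y x)) +
      (if x < y then scale (v - inverse v) (e l) else 0) + w"
    and w: "Poly_Mapping.keys w \<subseteq> {upd2 l i z (x + y - z) | z.
      if x < y then x + int n \<le> z \<and> z < y else y < z \<and> z < x}"
    using T_e[OF assms(1), of v] unfolding x_def[symmetric] y_def[symmetric] by blast
  have "m = upd2 l i y x \<or> (x < y \<and> m = l) \<or> m \<in> Poly_Mapping.keys w"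
    using assms(2) unfolding T
    by (auto simp: in_keys_iff lookup_add e_def lookup_single when_def split: if_splits)
  moreover have "\<exists>z. m = upd2 l i z (x + y - z) \<and> min x y < z \<and> z < max x y"
    if mw: "m \<in> Poly_Mapping.keys w"
  proof -
    obtain z where "m = upd2 l i z (x + y - z)"
      "if x < y then x + int n \<le> z \<and> z < y else y < z \<and> z < x"
      using subsetD[OF w mw] unfolding mem_Collect_eq by blast
    moreover from this have "min x y < z" "z < max x y"
      using n_pos' by (auto split: if_splits simp del: n_pos')
    ultimately show ?thesis by blast
  qed
  ultimately show ?thesis by blast
qed

text \<open>Subtracting the multiple of the identity moves the diagonal term from
  \<open>x < y\<close> to \<open>y < x\<close>; for \<open>x = y\<close> it falls together with the
  exchanged weight. The gap \<open>n\<close> is kept because this operator also meets entries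
  lowered by some \<open>s < n\<close>.\<close>

lemma keys_Tinv:
  assumes "length l = N" "m \<in> Poly_Mapping.keys (Tinv n N v i (e l))"
  defines "x \<equiv> entry l i" and "y \<equiv> entry l (i + 1)"
  shows "m = upd2 l i y x \<or> y < x \<and> m = l \<or>
    (\<exists>z. m = upd2 l i z (x + y - z) \<and> (x + int n \<le> z \<and> z < y \<or> y < z \<and> z < x))"
proof -
  obtain c w where T: "T n N v i (e l) = scale c (e (upd2 l i y x)) +
      (if x < y then scale (v - inverse v) (e l) else 0) + w"
    and w: "Poly_Mapping.keys w \<subseteq> {upd2 l i z (x + y - z) | z.
      if x < y then x + int n \<le> z \<and> z < y else y < z \<and> z < x}"
    using T_e[OF assms(1), of v] unfolding x_def[symmetric] y_def[symmetric] by blast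
  have diag: "upd2 l i y x = l" if "x = y"
    using that by (simp add: x_def y_def) (metis upd2_same)
  have "Tinv n N v i (e l) = scale c (e (upd2 l i y x)) -
      (if x < y then 0 else scale (v - inverse v) (e l)) + w"
    unfolding Tinv_def T by simp
  then have "m = upd2 l i y x \<or> (\<not> x < y \<and> m = l) \<or> m \<in> Poly_Mapping.keys w"
    using assms(2)
    by (auto simp: in_keys_iff lookup_add lookup_minus e_def lookup_single when_def split: if_splits)
  moreover have "m = upd2 l i y x \<or> y < x" if "\<not> x < y" "m = l"
    using that diag by (cases "x = y") auto
  moreover have "\<exists>z. m = upd2 l i z (x + y - z) \<and> (x + int n \<le> z \<and> z < y \<or> y < z \<and> z < x)"
    if "m \<in> Poly_Mapping.keys w"
    using subsetD[OF w that] by (auto split: if_splits)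
  ultimately show ?thesis by blast
qed

end

section \<open>Inverting products of Hecke generators and the operator \<open>X1\<close>\<close>

lemma adjacentI: "n \<ge> 1 \<Longrightarrow> t \<in> {1..<N} \<Longrightarrow> adjacent n N t"
  by unfold_locales auto

lemma tlin_comps_T: "n \<ge> 1 \<Longrightarrow> set ts \<subseteq> {1..<N} \<Longrightarrow> tlin N (comps (map (T n N v) ts))"
  and tlin_comps_Tinv: "n \<ge> 1 \<Longrightarrow> set ts \<subseteq> {1..<N} \<Longrightarrow> tlin N (comps (map (Tinv n N v) ts))"
  by (rule tlin_comps; use adjacent.tlin_T[OF adjacentI] adjacent.tlin_Tinv[OF adjacentI] in auto)+

lemma comps_T_Tinv:
  assumes "n \<ge> 1" "v \<noteq> 0" "set ts \<subseteq> {1..<N}" "f \<in> tensor_space N"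
  shows "comps (map (T n N v) ts) (comps (map (Tinv n N v) (rev ts)) f) = f"
  using assms(3,4)
proof (induction ts arbitrary: f)
  case (Cons t ts)
  have t: "adjacent n N t" using Cons.prems assms(1) by (intro adjacentI) auto
  have "Tinv n N v t f \<in> tensor_space N"
    by (rule tlin_mem[OF adjacent.tlin_Tinv[OF t] Cons.prems(2)])
  then show ?case using Cons adjacent.T_Tinv[OF t assms(2) Cons.prems(2)] by simp
qed simp

lemma comps_Tinv_T:
  assumes "n \<ge> 1" "v \<noteq> 0" "set ts \<subseteq> {1..<N}" "f \<in> tensor_space N"
  shows "comps (map (Tinv n N v) (rev ts)) (comps (map (T n N v) ts) f) = f"
  using assms(3,4)
proof (induction ts arbitrary: f)
  case (Cons t ts)
  have t: "adjacent n N t" using Cons.prems assms(1) by (intro adjacentI) auto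
  have "comps (map (T n N v) ts) f \<in> tensor_space N"
    using Cons.prems assms(1) by (intro tlin_mem[OF tlin_comps_T]) auto
  then show ?case using Cons adjacent.Tinv_T[OF t assms(2)] by simp
qed simp

text \<open>Evaluating \<open>inv_into\<close> in \<open>X1\<close> and \<open>X1_inv\<close>
  requires the factors of \<open>pi_op\<close> to be bijective; it is enough to give an inverse on
  basis vectors.\<close>

lemma bij_betw_linear_ext:
  assumes "\<And>l. length l = N \<Longrightarrow> F l \<in> tensor_space N" "\<And>l. length l = N \<Longrightarrow> G l \<in> tensor_space N"
    and "\<And>l. length l = N \<Longrightarrow> linear_ext G (F l) = e l" "\<And>l. length l = N \<Longrightarrow> linear_ext F (G l) = e l"
  shows "bij_betw (linear_ext F) (tensor_space N) (tensor_space N)"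
proof -
  have F: "tlin N (linear_ext F)" and G: "tlin N (linear_ext G)"
    by (rule tlin_linear_ext; use assms(1,2) in blast)+
  show ?thesis
  proof (rule bij_betw_byWitness[of _ "linear_ext G"])
    show "\<forall>f\<in>tensor_space N. linear_ext G (linear_ext F f) = f"
      using tlin_eqI[OF tlin_comp[OF G F] tlin_id] assms(3) by simp
    show "\<forall>f\<in>tensor_space N. linear_ext F (linear_ext G f) = f"
      using tlin_eqI[OF tlin_comp[OF F G] tlin_id] assms(4) by simp
  qed (use tlin_mem[OF F] tlin_mem[OF G] in auto)
qed

lemma bij_betw_s_fac:
  assumes "t \<in> {1..<N}"
  shows "bij_betw (s_fac t) (tensor_space N) (tensor_space N)"
proof -
  let ?F = "\<lambda>l. e (set_entry (set_entry l t (entry l (t + 1))) (t + 1) (entry l t))"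
  show ?thesis
    unfolding s_fac_def
    by (rule bij_betw_linear_ext[of N ?F ?F]) (use assms in \<open>simp_all add: set_entry_swap\<close>)
qed

lemma bij_betw_kappa1:
  assumes "N \<ge> 1"
  shows "bij_betw kappa1 (tensor_space N) (tensor_space N)"
  unfolding kappa1_def
  by (rule bij_betw_linear_ext[of N _ "\<lambda>l. e (set_entry l 1 (entry l 1 + 1))"])
    (use assms in simp_all)

lemma bij_betw_D1:
  assumes "n \<ge> 1" "q \<noteq> 0" "\<And>a. a < n \<Longrightarrow> u a \<noteq> 0"
  shows "bij_betw (D1 n q u) (tensor_space N) (tensor_space N)"
  unfolding D1_def
proof (rule bij_betw_linear_ext[of N _ "\<lambda>l. scale (inverse (u (nat (entry l 1 mod int n)) *
      q powi (entry l 1 div int n))) (e l)"])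
  fix l :: weight assume l: "length l = N"
  define c where "c l = u (nat (entry l 1 mod int n)) * q powi (entry l 1 div int n)" for l :: weight
  have c: "c l \<noteq> 0"
    using assms by (simp add: c_def nat_less_iff)
  have tl: "tlin N (linear_ext (\<lambda>l. scale (inverse (c l)) (e l)))" "tlin N (linear_ext (\<lambda>l. scale (c l) (e l)))"
    by (rule tlin_linear_ext; simp)+
  show "linear_ext (\<lambda>l. scale (inverse (u (nat (entry l 1 mod int n)) * q powi (entry l 1 div int n))) (e l))
      (scale (u (nat (entry l 1 mod int n)) * q powi (entry l 1 div int n)) (e l)) = e l"
    unfolding c_def[symmetric] using l c by (simp add: tlin_scale[OF tl(1)])
  show "linear_ext (\<lambda>l. scale (u (nat (entry l 1 mod int n)) * q powi (entry l 1 div int n)) (e l))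
      (scale (inverse (u (nat (entry l 1 mod int n)) * q powi (entry l 1 div int n))) (e l)) = e l"
    unfolding c_def[symmetric] using l c by (simp add: tlin_scale[OF tl(2)])
qed simp_all

lemma bij_betw_funpow: "bij_betw F A A \<Longrightarrow> bij_betw (F ^^ k) A A"
  by (induction k) (simp_all add: bij_betw_trans)

lemma bij_betw_comps: "(\<And>F. F \<in> set Fs \<Longrightarrow> bij_betw F A A) \<Longrightarrow> bij_betw (comps Fs) A A"
proof (induction Fs)
  case Nil
  then show ?case by (simp add: comps_def bij_betw_def inj_on_def)
next
  case (Cons F Fs)
  then have "bij_betw (comps Fs) A A" "bij_betw F A A" by simp_all
  then have "bij_betw (F \<circ> comps Fs) A A" by (rule bij_betw_trans)
  moreover have "comps (F # Fs) = F \<circ> comps Fs" by (rule ext) simp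
  ultimately show ?case by (simp only:)
qed

lemma bij_betw_pi_op:
  assumes "n \<ge> 1" "N \<ge> 1" "q \<noteq> 0" "\<And>a. a < n \<Longrightarrow> u a \<noteq> 0"
  shows "bij_betw (pi_op n ntw N q u) (tensor_space N) (tensor_space N)"
proof -
  have 1: "bij_betw (comps (map s_fac [1..<N])) (tensor_space N) (tensor_space N)"
    by (rule bij_betw_comps) (auto intro: bij_betw_s_fac)
  have 2: "bij_betw (D1 n q u) (tensor_space N) (tensor_space N)"
    by (rule bij_betw_D1[OF assms(1,3,4)])
  have 3: "bij_betw (kappa1 ^^ ntw) (tensor_space N) (tensor_space N)"
    by (rule bij_betw_funpow[OF bij_betw_kappa1[OF assms(2)]])
  show ?thesis
    unfolding pi_op_def by (rule bij_betw_trans[OF 1 bij_betw_trans[OF 2 3], unfolded comp_assoc[symmetric]])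
qed

text \<open>The generators of index below \<open>k\<close> cancel against the inverse of
  \<open>X1\<close>, leaving the inverses of index \<open>k\<close> to \<open>N - 1\<close>. The
  right-hand side is sent by \<open>X1\<close> to the argument on the left, and \<open>X1\<close> is
  injective. For \<open>k = 1\<close> this is the formula for \<open>X1_inv\<close> itself.\<close>

lemma X1_inv_comps_T:
  assumes "n \<ge> 1" "N \<ge> 1" "q \<noteq> 0" "v \<noteq> 0" "\<And>a. a < n \<Longrightarrow> u a \<noteq> 0"
    and "k \<in> {1..N}" "f \<in> tensor_space N"
  shows "X1_inv n ntw N q v u (comps (map (T n N v) [1..<k]) f) =
    pi_op n ntw N q u (comps (map (Tinv n N v) (rev [k..<N])) f)"
proof -
  let ?P = "pi_op n ntw N q u" and ?TS = "tensor_space N"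
  let ?X = "X1 n ntw N q v u" and ?T = "comps (map (T n N v) [1..<N])"
  let ?g = "comps (map (Tinv n N v) (rev [k..<N])) f"
  have P: "bij_betw ?P ?TS ?TS" using assms by (intro bij_betw_pi_op) auto
  have g: "?g \<in> ?TS"
    using assms by (intro tlin_mem[OF tlin_comps_Tinv]) auto
  then have Pg: "?P ?g \<in> ?TS" using P by (auto simp: bij_betw_def)
  have "inj_on ?T ?TS"
    by (rule inj_on_inverseI[of _ "comps (map (Tinv n N v) (rev [1..<N]))"])
      (use assms in \<open>auto intro: comps_Tinv_T\<close>)
  moreover have inv: "bij_betw (inv_into ?TS ?P) ?TS ?TS" by (rule bij_betw_inv_into[OF P])
  ultimately have inj: "inj_on ?X ?TS"
    unfolding X1_def by (intro comp_inj_on) (auto simp: bij_betw_def)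
  have "[1..<N] = [1..<k] @ [k..<N]"
    using assms(6) by (metis atLeastAtMost_iff le_add_diff_inverse upt_add_eq_append)
  then have "?T ?g = comps (map (T n N v) [1..<k]) f"
    using assms comps_T_Tinv[of n v "[k..<N]" N f] by simp
  moreover have "?X (?P ?g) = ?T ?g"
    using inv_into_f_f[OF bij_betw_imp_inj_on[OF P] g] by (simp add: X1_def)
  ultimately have "X1_inv n ntw N q v u (comps (map (T n N v) [1..<k]) f) =
      inv_into ?TS ?X (?X (?P ?g))"
    by (simp add: X1_inv_def)
  then show ?thesis using inv_into_f_f[OF inj Pg] by simp
qed

section \<open>The dominance order\<close>

definition psum :: "weight \<Rightarrow> nat \<Rightarrow> int" where
  "psum l k = (\<Sum>j<k. l ! j)"

lemma psum_Suc: "psum l (Suc k) = psum l k + l ! k"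
  by (simp add: psum_def)

lemma psum_diff_entry: "1 \<le> k \<Longrightarrow> psum l k - psum l (k - 1) = entry l k"
  by (cases k) (simp_all add: psum_Suc entry_def)

lemma sum_simple_roots:
  fixes c :: "nat \<Rightarrow> int"
  assumes "k \<in> {1..m}"
  shows "(\<Sum>i\<in>{1..<m}. c i * (of_bool (k = i) - of_bool (k = i + 1))) =
    (if k < m then c k else 0) - (if 1 < k then c (k - 1) else 0)"
proof -
  have "(\<Sum>i\<in>{1..<m}. c i * (of_bool (k = i) - of_bool (k = i + 1))) =
      (\<Sum>i\<in>{1..<m}. if k = i then c i else 0) - (\<Sum>i\<in>{1..<m}. if k - 1 = i then c i else 0)"
    unfolding sum_subtractf[symmetric] by (intro sum.cong) auto
  then show ?thesis using assms by auto
qed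

text \<open>The coefficient of the \<open>k\<close>-th simple root in \<open>m - l\<close> is the
  difference of the \<open>k\<close>-th partial sums.\<close>

lemma dom_le_iff:
  "dom_le l m \<longleftrightarrow> length l = length m \<and> psum l (length m) = psum m (length m) \<and>
     (\<forall>k<length m. psum l k \<le> psum m k)"
proof (intro iffI conjI allI impI)
  assume "dom_le l m"
  then obtain c :: "nat \<Rightarrow> nat" where len: "length l = length m" and c: "\<And>k. k \<in> {1..length m} \<Longrightarrow>
      entry m k - entry l k = (\<Sum>i\<in>{1..<length m}. int (c i) * (of_bool (k = i) - of_bool (k = i + 1)))"
    unfolding dom_le_def by blast
  show "length l = length m" by (fact len)
  have D: "psum m k - psum l k = (if 0 < k \<and> k < length m then int (c k) else 0)"
    if "k \<le> length m" for k
    using that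
  proof (induction k)
    case 0
    then show ?case by (simp add: psum_def)
  next
    case (Suc k)
    then have "Suc k \<in> {1..length m}" by simp
    from c[OF this] sum_simple_roots[OF this, of "\<lambda>i. int (c i)"] Suc
    show ?case by (auto simp: psum_Suc entry_def split: if_splits)
  qed
  show "psum l (length m) = psum m (length m)" using D[of "length m"] by simp
  show "psum l k \<le> psum m k" if "k < length m" for k
    using D[of k] that by (auto split: if_splits)
next
  assume *: "length l = length m \<and> psum l (length m) = psum m (length m) \<and>
     (\<forall>k<length m. psum l k \<le> psum m k)"
  define c where "c k = nat (psum m k - psum l k)" for k
  have c: "int (c k) = psum m k - psum l k" if "k \<le> length m" for k
    using * that by (cases "k = length m") (auto simp: c_def)
  have "entry m k - entry l k =
      (\<Sum>i\<in>{1..<length m}. int (c i) * (of_bool (k = i) - of_bool (k = i + 1)))"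
    if k: "k \<in> {1..length m}" for k
  proof -
    have "(if k < length m then int (c k) else 0) = psum m k - psum l k"
      using k * by (auto simp: c)
    moreover have "(if 1 < k then int (c (k - 1)) else 0) = psum m (k - 1) - psum l (k - 1)"
      using k by (auto simp: c psum_def)
    ultimately show ?thesis
      using k unfolding sum_simple_roots[OF k] by (simp flip: psum_diff_entry)
  qed
  with * show "dom_le l m" unfolding dom_le_def by blast
qed

lemma dom_le_trans:
  assumes "dom_le l m" "dom_le m k"
  shows "dom_le l k"
  unfolding dom_le_iff
proof (intro conjI allI impI)
  fix j assume "j < length k"
  then have "psum l j \<le> psum m j" "psum m j \<le> psum k j"
    using assms unfolding dom_le_iff by metis+
  then show "psum l j \<le> psum k j" by linarith
qed (use assms[unfolded dom_le_iff] in metis)+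

lemma dom_le_antisym:
  assumes "dom_le l m" "dom_le m l"
  shows "l = m"
proof (rule nth_equalityI)
  show len: "length l = length m" using assms by (simp add: dom_le_iff)
  have *: "psum l k = psum m k" if "k \<le> length m" for k
  proof (cases "k = length m")
    case True
    then show ?thesis using assms(1) by (simp add: dom_le_iff)
  next
    case False
    then have "k < length m" "k < length l" using that len by simp_all
    then have "psum l k \<le> psum m k" "psum m k \<le> psum l k"
      using assms unfolding dom_le_iff by blast+
    then show ?thesis by linarith
  qed
  fix k assume "k < length l"
  then show "l ! k = m ! k" using *[of k] *[of "Suc k"] len by (simp add: psum_Suc)
qed

lemma dom_less_trans: "dom_less l m \<Longrightarrow> dom_less m k \<Longrightarrow> dom_less l k"
  unfolding dom_less_def by (metis dom_le_trans dom_le_antisym)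

lemma prec_trans: "prec l m \<Longrightarrow> prec m k \<Longrightarrow> prec l k"
  unfolding prec_def using dom_less_trans by metis

section \<open>Dominance of decreasing rearrangements\<close>

lemma mset_dec_rearr [simp]: "mset (dec_rearr l) = mset l"
  by (simp add: dec_rearr_def)

lemma length_dec_rearr [simp]: "length (dec_rearr l) = length l"
  by (simp add: dec_rearr_def)

lemma sum_nth_dec_rearr:
  fixes f :: "int \<Rightarrow> int"
  shows "(\<Sum>j<length l. f (dec_rearr l ! j)) = (\<Sum>j<length l. f (l ! j))"
proof -
  have *: "(\<Sum>j<length k. f (k ! j)) = sum_mset (image_mset f (mset k))" for k :: "int list"
    unfolding mset_map[symmetric] sum_mset_sum_list
    by (simp add: sum_list_sum_nth atLeast0LessThan)
  show ?thesis using *[of l] *[of "dec_rearr l"] by simp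
qed

text \<open>The sum of the \<open>k\<close> largest entries of \<open>l\<close> is the minimum over \<open>t\<close> of \<open>k t + \<Sum>\<^sub>j max (l\<^sub>j - t) 0\<close>, so
  the dominance of rearrangements reduces to an inequality that is additive in the entries.\<close>

lemma psum_le_threshold:
  assumes "k \<le> length l"
  shows "psum l k \<le> int k * t + (\<Sum>j<length l. max (l ! j - t) 0)"
proof -
  have "psum l k - int k * t = (\<Sum>j<k. l ! j - t)"
    by (simp add: psum_def sum_subtractf)
  also have "\<dots> \<le> (\<Sum>j<k. max (l ! j - t) 0)" by (rule sum_mono) simp
  also have "\<dots> \<le> (\<Sum>j<length l. max (l ! j - t) 0)"
    using assms by (intro sum_mono2) auto
  finally show ?thesis by simp
qed

text \<open>The minimum is attained when the threshold is the smallest of the \<open>Suc k\<close>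
  largest entries: these contribute their full excess over \<open>t\<close>, all later ones
  contribute 0.\<close>

lemma psum_dec_rearr_threshold:
  assumes "k < length l"
  defines "t \<equiv> dec_rearr l ! k"
  shows "psum (dec_rearr l) (Suc k) = int (Suc k) * t + (\<Sum>j<length l. max (l ! j - t) 0)"
proof -
  let ?d = "dec_rearr l"
  have mono: "?d ! b \<le> ?d ! a" if "a \<le> b" "b < length l" for a b
    using that sorted_nth_mono[of "sort l" "length l - Suc b" "length l - Suc a"]
    by (simp add: dec_rearr_def rev_nth)
  have "(\<Sum>j<length l. max (l ! j - t) 0) = (\<Sum>j<length l. max (?d ! j - t) 0)"
    using sum_nth_dec_rearr[of "\<lambda>x. max (x - t) 0" l] by simp
  also have "\<dots> = (\<Sum>j<Suc k. max (?d ! j - t) 0)"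
    using assms(1) mono unfolding t_def by (intro sum.mono_neutral_right) (auto simp: not_less)
  also have "\<dots> = (\<Sum>j<Suc k. ?d ! j - t)"
    using assms(1) mono unfolding t_def by (intro sum.cong) auto
  also have "\<dots> = psum ?d (Suc k) - int (Suc k) * t"
    by (simp add: psum_def sum_subtractf)
  finally show ?thesis by simp
qed

text \<open>With the threshold chosen from \<open>m\<close>, the bound is an equality for
  \<open>m\<close> and still an upper bound for \<open>l\<close>.\<close>

lemma dom_le_dec_rearrI:
  assumes "length l = length m" "(\<Sum>j<length m. l ! j) = (\<Sum>j<length m. m ! j)"
    and "\<And>t. (\<Sum>j<length m. max (l ! j - t) 0) \<le> (\<Sum>j<length m. max (m ! j - t) 0)"
  shows "dom_le (dec_rearr l) (dec_rearr m)"
  unfolding dom_le_iff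
proof (intro conjI allI impI)
  show "psum (dec_rearr l) (length (dec_rearr m)) = psum (dec_rearr m) (length (dec_rearr m))"
    using sum_nth_dec_rearr[of "\<lambda>x. x" l] sum_nth_dec_rearr[of "\<lambda>x. x" m] assms(1,2)
    by (simp add: psum_def)
  fix k assume k: "k < length (dec_rearr m)"
  show "psum (dec_rearr l) k \<le> psum (dec_rearr m) k"
  proof (cases k)
    case 0
    then show ?thesis by (simp add: psum_def)
  next
    case (Suc j)
    define t where "t = dec_rearr m ! j"
    have "psum (dec_rearr l) k \<le> int k * t + (\<Sum>j<length (dec_rearr l). max (dec_rearr l ! j - t) 0)"
      using k assms(1) by (intro psum_le_threshold) simp
    also have "\<dots> = int k * t + (\<Sum>j<length m. max (l ! j - t) 0)"
      using sum_nth_dec_rearr[of "\<lambda>x. max (x - t) 0" l] assms(1) by simp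
    also have "\<dots> \<le> int k * t + (\<Sum>j<length m. max (m ! j - t) 0)"
      using assms(3) by simp
    also have "\<dots> = psum (dec_rearr m) k"
      using psum_dec_rearr_threshold[of j m] k Suc by (simp add: t_def)
    finally show ?thesis .
  qed
qed (use assms(1) in simp)

section \<open>Two moves that lower a weight\<close>

lemma sum_nth_update:
  fixes f :: "int \<Rightarrow> int"
  assumes "a < length l" "k \<le> length l"
  shows "(\<Sum>j<k. f (l[a := x] ! j)) = (\<Sum>j<k. f (l ! j)) + (if a < k then f x - f (l ! a) else 0)"
proof -
  have "(\<Sum>j<k. f (l[a := x] ! j)) - (\<Sum>j<k. f (l ! j)) =
      (\<Sum>j<k. if a = j then f x - f (l ! a) else 0)"
    unfolding sum_subtractf[symmetric] using assms by (intro sum.cong) (auto simp: nth_list_update)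
  then show ?thesis by (simp add: algebra_simps)
qed

text \<open>Moving two entries towards each other with fixed sum does not increase sums of convex
  functions of the entries, in particular the threshold sums.\<close>

lemma prec_between:
  assumes "a < length l" "b < length l" "a \<noteq> b" "x + y = l ! a + l ! b"
    and "min (l ! a) (l ! b) < y" "y < max (l ! a) (l ! b)"
  shows "prec (l[a := x, b := y]) l"
proof -
  let ?m = "l[a := x, b := y]"
  have sums: "(\<Sum>j<length l. f (?m ! j)) = (\<Sum>j<length l. f (l ! j)) + (f x + f y - f (l ! a) - f (l ! b))"
    for f :: "int \<Rightarrow> int"
    using assms(1-3) by (simp add: sum_nth_update)
  have x: "x = l ! a + l ! b - y" using assms(4) by simp
  have "dom_le (dec_rearr ?m) (dec_rearr l)"
  proof (rule dom_le_dec_rearrI)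
    show "(\<Sum>j<length l. ?m ! j) = (\<Sum>j<length l. l ! j)"
      using sums[of "\<lambda>x. x"] assms(4) by simp
    show "(\<Sum>j<length l. max (?m ! j - t) 0) \<le> (\<Sum>j<length l. max (l ! j - t) 0)" for t
      unfolding sums[of "\<lambda>x. max (x - t) 0"] using assms(4-6) by linarith
  qed simp
  \<comment> \<open>Strictness: the sum of squares is invariant under rearrangement, but changes
    here by 2 (y - l_a) (y - l_b), which is nonzero.\<close>
  moreover have "dec_rearr ?m \<noteq> dec_rearr l"
  proof
    assume "dec_rearr ?m = dec_rearr l"
    then have "(\<Sum>j<length l. (?m ! j)\<^sup>2) = (\<Sum>j<length l. (l ! j)\<^sup>2)"
      using sum_nth_dec_rearr[of "\<lambda>x. x\<^sup>2" ?m] sum_nth_dec_rearr[of "\<lambda>x. x\<^sup>2" l] by simp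
    then have "x\<^sup>2 + y\<^sup>2 - (l ! a)\<^sup>2 - (l ! b)\<^sup>2 = 0"
      unfolding sums[of "\<lambda>x. x\<^sup>2"] by simp
    then have "(y - l ! a) * (y - l ! b) = 0"
      unfolding x by (simp add: power2_eq_square algebra_simps)
    then show False using assms(5,6) by auto
  qed
  ultimately show ?thesis by (simp add: prec_def dom_less_def)
qed

text \<open>The rearrangement is unchanged, and moving the larger entry to the right lowers exactly
  the partial sums that contain position \<open>a\<close> but not \<open>b\<close>.\<close>

lemma prec_swap:
  assumes "a < b" "b < length l" "l ! b < l ! a"
  shows "prec (l[a := l ! b, b := l ! a]) l"
proof -
  let ?m = "l[a := l ! b, b := l ! a]"
  have "mset ?m = mset l" using assms mset_swap[of b l a] by simp
  then have "dec_rearr ?m = dec_rearr l"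
    by (simp add: dec_rearr_def properties_for_sort)
  moreover have "psum ?m k = psum l k + (if a < k \<and> k \<le> b then l ! b - l ! a else 0)"
    if "k \<le> length l" for k
    using that assms unfolding psum_def
    by (simp add: sum_nth_update[of _ _ _ "\<lambda>x. x"])
  then have "dom_le ?m l" using assms by (auto simp: dom_le_iff)
  moreover have "?m ! a \<noteq> l ! a" using assms by simp
  ultimately show ?thesis by (auto simp: prec_def dom_less_def)
qed

section \<open>Carrying one entry of a weight\<close>

text \<open>\<open>phys i p s l\<close> is \<open>l\<close> with the entry at list position \<open>i\<close> lowered by \<open>s\<close> and moved to
  position \<open>p\<close>; \<open>slot i p\<close> is the position in \<open>l\<close> of the entry to the right of the moved one. While the
  factors of \<open>B\<^bsub>i+1\<^esub>\<close> are applied, one entry is carried around and shifted, but its contribution to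
  the order is always evaluated at its home position \<open>i\<close> and without the shift.\<close>

definition slot :: "nat \<Rightarrow> nat \<Rightarrow> nat" where
  "slot i p = (if p < i then p else Suc p)"

definition phys :: "nat \<Rightarrow> nat \<Rightarrow> int \<Rightarrow> weight \<Rightarrow> weight" where
  "phys i p s l = map (\<lambda>m. if m < p then l ! slot i m else if m = p then l ! i - s
     else l ! slot i (m - 1)) [0..<length l]"

definition preceq :: "weight \<Rightarrow> weight \<Rightarrow> bool" where
  "preceq l m \<longleftrightarrow> l = m \<or> prec l m"

text \<open>The invariant of the argument: weights that lie weakly below \<open>l\<close> once the
  carried entry is back at \<open>i\<close> with its shift undone.\<close>

definition carried :: "nat \<Rightarrow> nat \<Rightarrow> int \<Rightarrow> weight \<Rightarrow> weight set" where
  "carried i p s l = {phys i p s m | m. length m = length l \<and> preceq m l}"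

lemma length_phys [simp]: "length (phys i p s l) = length l"
  by (simp add: phys_def)

lemma nth_phys: "m < length l \<Longrightarrow> phys i p s l ! m =
    (if m < p then l ! slot i m else if m = p then l ! i - s else l ! slot i (m - 1))"
  by (simp add: phys_def)

lemma phys_id: "phys i i 0 l = l"
  by (rule nth_equalityI) (auto simp: nth_phys slot_def)

lemma entry_phys:
  assumes "Suc p < length l"
  shows "entry (phys i p s l) (Suc p) = l ! i - s" "entry (phys i p s l) (Suc (Suc p)) = l ! slot i p"
  using assms by (simp_all add: entry_def nth_phys)

text \<open>Any two values written at list positions \<open>p\<close> and \<open>Suc p\<close> can
  be read as the carried entry having moved one place to the right: \<open>y\<close> corresponds to
  the home value \<open>y + s\<close>, and \<open>x\<close> belongs to the entry passed. The index
  \<open>Suc p\<close> of \<open>upd2\<close> counts from 1.\<close>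

lemma phys_step:
  assumes "Suc p < length l" "i < length l"
  shows "upd2 (phys i p s l) (Suc p) x y = phys i (Suc p) s (l[i := y + s, slot i p := x])"
proof (rule nth_equalityI)
  fix m assume "m < length (upd2 (phys i p s l) (Suc p) x y)"
  then have m: "m < length l" by simp
  have inj: "slot i a = slot i b \<longleftrightarrow> a = b" "slot i a \<noteq> i" "i \<noteq> slot i a" for a b
    by (auto simp: slot_def)
  have len: "slot i p < length l" using assms by (simp add: slot_def)
  consider "m < p" | "m = p" | "m = Suc p" | "m > Suc p" by linarith
  then show "upd2 (phys i p s l) (Suc p) x y ! m = phys i (Suc p) s (l[i := y + s, slot i p := x]) ! m"
    using m len assms by cases (simp_all add: nth_phys set_entry_def inj)
qed simp

lemma phys_step_back:
  assumes "Suc p < length l"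
  shows "upd2 (phys i (Suc p) s l) (Suc p) (l ! i - s) (l ! slot i p) = phys i p s l"
proof (rule nth_equalityI)
  fix m assume "m < length (upd2 (phys i (Suc p) s l) (Suc p) (l ! i - s) (l ! slot i p))"
  then have m: "m < length l" by simp
  consider "m < p" | "m = p" | "m = Suc p" | "m > Suc p" by linarith
  then show "upd2 (phys i (Suc p) s l) (Suc p) (l ! i - s) (l ! slot i p) ! m = phys i p s l ! m"
    using m assms by cases (simp_all add: nth_phys set_entry_def)
qed simp

lemma phys_shift:
  assumes "l \<noteq> []"
  shows "set_entry (phys i 0 s l) 1 (entry (phys i 0 s l) 1 + c) = phys i 0 (s - c) l"
  using assms by (intro nth_equalityI) (auto simp: nth_phys set_entry_def entry_def nth_list_update)

section \<open>Carried weights under the Hecke generators and their inverses\<close>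

lemma length_carried: "m \<in> carried i p s l \<Longrightarrow> length m = length l"
  by (auto simp: carried_def)

lemma carried_memI: "length m = length l \<Longrightarrow> preceq m l \<Longrightarrow> phys i p s m \<in> carried i p s l"
  by (auto simp: carried_def)

lemma preceq_trans_prec: "prec k m \<Longrightarrow> preceq m l \<Longrightarrow> preceq k l"
  by (metis preceq_def prec_trans)

text \<open>The bounds on \<open>z\<close> use the home value \<open>m ! i\<close> instead of the
  visible \<open>m ! i - s\<close>. The new home value \<open>w + s\<close> and \<open>z\<close>
  have the same sum as the old pair, so \<open>prec_between\<close> applies.\<close>

lemma carried_step_between:
  assumes m: "length m = length l" "preceq m l" and "Suc p < length l" "i < length l"
    and "min (m ! i) (m ! slot i p) < z" "z < max (m ! i) (m ! slot i p)"
    and "w = m ! i - s + m ! slot i p - z"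
  shows "upd2 (phys i p s m) (Suc p) z w \<in> carried i (Suc p) s l"
proof -
  have "prec (m[i := w + s, slot i p := z]) m"
    using assms by (intro prec_between) (auto simp: slot_def)
  then have "preceq (m[i := w + s, slot i p := z]) l" by (rule preceq_trans_prec[OF _ m(2)])
  then have "phys i (Suc p) s (m[i := w + s, slot i p := z]) \<in> carried i (Suc p) s l"
    using m(1) by (intro carried_memI) simp_all
  then show ?thesis using assms(1,3,4) by (simp only: phys_step)
qed

lemma carried_step_swap:
  assumes m: "length m = length l" "preceq m l" and "Suc p < length l" "i < length l"
  shows "upd2 (phys i p s m) (Suc p) (m ! slot i p) (m ! i - s) \<in> carried i (Suc p) s l"
proof -
  have "phys i (Suc p) s m \<in> carried i (Suc p) s l" using m by (rule carried_memI)
  moreover have "m[i := m ! i - s + s, slot i p := m ! slot i p] = m" by simp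
  ultimately show ?thesis using assms(1,3,4) by (simp only: phys_step)
qed

text \<open>The carried entry is still left of its home, so the entry it passes sits at
  \<open>p < i\<close> in \<open>m\<close>. The diagonal term, present for
  \<open>m ! i < m ! p\<close>, then reads as an exchange that lowers \<open>m\<close> by
  \<open>prec_swap\<close>.\<close>

lemma keys_T_carried:
  assumes "n \<ge> 1" "p < i" "i < length l" "k \<in> carried i p 0 l"
  shows "Poly_Mapping.keys (T n (length l) v (Suc p) (e k)) \<subseteq> carried i (Suc p) 0 l"
proof
  fix j assume j: "j \<in> Poly_Mapping.keys (T n (length l) v (Suc p) (e k))"
  obtain m where k: "k = phys i p 0 m" and m: "length m = length l" "preceq m l"
    using assms(4) by (auto simp: carried_def)
  define x y where "x = m ! i" and "y = m ! p"
  have p: "Suc p < length l" "slot i p = p" using assms by (simp_all add: slot_def)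
  have ent: "entry k (Suc p) = x" "entry k (Suc p + 1) = y"
    using entry_phys[of p m i 0] p m by (simp_all add: k x_def y_def)
  have k_eq: "upd2 k (Suc p) x y = k"
    unfolding ent[symmetric] by simp
  interpret adjacent n "length l" "Suc p" using assms p by unfold_locales auto
  have "length k = length l" using m by (simp add: k)
  then consider "j = upd2 k (Suc p) y x" | "x < y" "j = k" |
    z where "j = upd2 k (Suc p) z (x + y - z)" "min x y < z" "z < max x y"
    using keys_T[OF _ j] unfolding ent by blast
  then show "j \<in> carried i (Suc p) 0 l"
  proof cases
    case 1
    then show ?thesis using carried_step_swap[OF m p(1) assms(3), of 0] p by (simp add: k x_def y_def)
  next
    case 2
    have "prec (m[p := m ! i, i := m ! p]) m"
      using 2 assms m by (intro prec_swap) (auto simp: x_def y_def)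
    then have "preceq (m[i := y + 0, slot i p := x]) l"
      using preceq_trans_prec m(2) assms(2) by (simp add: x_def y_def p list_update_swap)
    then have "phys i (Suc p) 0 (m[i := y + 0, slot i p := x]) \<in> carried i (Suc p) 0 l"
      using m by (intro carried_memI) simp_all
    then show ?thesis
      using phys_step[of p m i 0 x y] p m assms(3) 2 k_eq by (simp add: k)
  next
    case 3
    then show ?thesis
      using carried_step_between[OF m p(1) assms(3), of z "x + y - z" 0] p
      by (simp add: k x_def y_def)
  qed
qed

text \<open>For \<open>s = 0\<close> the carried entry passes entries right of its home, where the
  diagonal term is a \<open>prec_swap\<close>. For \<open>s > 0\<close> the shift makes the diagonal
  term a strict move towards each other, and \<open>s < int n\<close> keeps the remaining terms
  strictly between the home values.\<close>

lemma keys_Tinv_carried: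
  assumes "n \<ge> 1" "Suc p < length l" "i < length l" "0 \<le> s" "s < int n" "s = 0 \<Longrightarrow> i \<le> p"
    and "k \<in> carried i p s l"
  shows "Poly_Mapping.keys (Tinv n (length l) v (Suc p) (e k)) \<subseteq> carried i (Suc p) s l"
proof
  fix j assume j: "j \<in> Poly_Mapping.keys (Tinv n (length l) v (Suc p) (e k))"
  obtain m where k: "k = phys i p s m" and m: "length m = length l" "preceq m l"
    using assms(7) by (auto simp: carried_def)
  define x y where "x = m ! i - s" and "y = m ! slot i p"
  have ent: "entry k (Suc p) = x" "entry k (Suc p + 1) = y"
    using entry_phys[of p m i s] assms m by (simp_all add: k x_def y_def)
  have k_eq: "upd2 k (Suc p) x y = k"
    unfolding ent[symmetric] by simp
  interpret adjacent n "length l" "Suc p" using assms by unfold_locales auto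
  have "length k = length l" using m by (simp add: k)
  then consider "j = upd2 k (Suc p) y x" | "y < x" "j = k" |
    z where "j = upd2 k (Suc p) z (x + y - z)" "x + int n \<le> z \<and> z < y \<or> y < z \<and> z < x"
    using keys_Tinv[OF _ j] unfolding ent by blast
  then show "j \<in> carried i (Suc p) s l"
  proof cases
    case 1
    then show ?thesis
      using carried_step_swap[OF m assms(2,3), of s] by (simp add: k x_def y_def)
  next
    case 2
    show ?thesis
    proof (cases "s = 0")
      case True
      then have sl: "slot i p = Suc p" "i < Suc p" using assms(6) by (simp_all add: slot_def)
      have "prec (m[i := m ! Suc p, Suc p := m ! i]) m"
        using 2 assms m sl True by (intro prec_swap) (auto simp: x_def y_def)
      then have "preceq (m[i := y + s, slot i p := x]) l"
        using preceq_trans_prec m(2) by (simp add: x_def y_def sl True)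
      then have "phys i (Suc p) s (m[i := y + s, slot i p := x]) \<in> carried i (Suc p) s l"
        using m by (intro carried_memI) simp_all
      then show ?thesis
        using phys_step[of p m i s x y] assms m 2 k_eq by (simp add: k)
    next
      case False
      \<comment> \<open>Here \<open>z = x\<close>, the visible value \<open>m ! i - s\<close>, which
        lies strictly between \<open>y\<close> and \<open>m ! i\<close> because
        \<open>s > 0\<close>.\<close>
      then have "upd2 k (Suc p) x y \<in> carried i (Suc p) s l"
        unfolding k using 2 assms(4)
        by (intro carried_step_between[OF m assms(2,3)]) (auto simp: x_def y_def)
      then show ?thesis using 2 k_eq by simp
    qed
  next
    case 3
    \<comment> \<open>\<open>s < int n\<close> turns \<open>x + int n \<le> z\<close> into
      \<open>m ! i < z\<close>, and \<open>0 \<le> s\<close> turns \<open>z < x\<close> into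
      \<open>z < m ! i\<close>.\<close>
    have "min (m ! i) (m ! slot i p) < z" "z < max (m ! i) (m ! slot i p)"
      using 3(2) assms(4,5) by (auto simp: x_def y_def)
    then show ?thesis
      unfolding 3(1) k by (intro carried_step_between[OF m assms(2,3)]) (auto simp: x_def y_def)
  qed
qed

lemma keys_comps_T_carried:
  assumes "n \<ge> 1" "k \<le> i" "i < length l" "Poly_Mapping.keys f \<subseteq> carried i 0 0 l"
  shows "Poly_Mapping.keys (comps (map (T n (length l) v) (rev [1..<Suc k])) f) \<subseteq> carried i k 0 l"
  using assms(2)
proof (induction k)
  case 0
  then show ?case using assms(4) by simp
next
  case (Suc k)
  have "Poly_Mapping.keys (T n (length l) v (Suc k) (comps (map (T n (length l) v) (rev [1..<Suc k])) f))
      \<subseteq> carried i (Suc k) 0 l"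
    by (rule tlin_keys[OF adjacent.tlin_T[OF adjacentI] _ length_carried keys_T_carried])
      (use Suc assms in auto)
  then show ?case by simp
qed

lemma keys_comps_Tinv_carried:
  assumes "n \<ge> 1" "i < length l" "0 \<le> s" "s < int n" "s = 0 \<Longrightarrow> i \<le> a"
    and "Poly_Mapping.keys f \<subseteq> carried i a s l" "a \<le> k" "k < length l"
  shows "Poly_Mapping.keys (comps (map (Tinv n (length l) v) (rev [Suc a..<Suc k])) f) \<subseteq> carried i k s l"
  using assms(7,8)
proof (induction k rule: dec_induct)
  case base
  then show ?case using assms(6) by simp
next
  case (step k)
  have "Poly_Mapping.keys (Tinv n (length l) v (Suc k)
      (comps (map (Tinv n (length l) v) (rev [Suc a..<Suc k])) f)) \<subseteq> carried i (Suc k) s l"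
    by (rule tlin_keys[OF adjacent.tlin_Tinv[OF adjacentI] _ length_carried keys_Tinv_carried])
      (use step assms(1-5) in auto)
  then show ?case using step by simp
qed

section \<open>Carried weights under the factors of \<open>B1\<close>\<close>

lemma keys_comps_s_fac_carried:
  assumes "k < length l" "Poly_Mapping.keys f \<subseteq> carried i k s l"
  shows "Poly_Mapping.keys (comps (map s_fac [1..<Suc k]) f) \<subseteq> carried i 0 s l"
  using assms
proof (induction k arbitrary: f)
  case (Suc k)
  \<comment> \<open>The factor of largest index acts first and moves the carried entry one place to
    the left, without changing the underlying weight.\<close>
  have "Poly_Mapping.keys (s_fac (Suc k) f) \<subseteq> carried i k s l"
  proof (rule tlin_keys[OF tlin_s_fac Suc.prems(2) length_carried])
    fix j assume "j \<in> carried i (Suc k) s l"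
    then obtain m where j: "j = phys i (Suc k) s m" and m: "length m = length l" "preceq m l"
      by (auto simp: carried_def)
    have "entry j (Suc k) = m ! slot i k" "entry j (Suc (Suc k)) = m ! i - s"
      using Suc.prems m by (simp_all add: j entry_def nth_phys)
    then have "s_fac (Suc k) (e j) = e (phys i k s m)"
      using Suc.prems m phys_step_back[of k m i s] by (simp add: s_fac_def j)
    then show "Poly_Mapping.keys (s_fac (Suc k) (e j)) \<subseteq> carried i k s l"
      using m by (simp add: carried_memI)
  qed
  then show ?case using Suc by simp
qed simp

lemma keys_D1:
  assumes "Poly_Mapping.keys f \<subseteq> S" "\<And>k. k \<in> S \<Longrightarrow> length k = N"
  shows "Poly_Mapping.keys (D1 n q u f) \<subseteq> S"
proof (rule tlin_keys[OF tlin_D1 assms])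
  fix k assume "k \<in> S"
  then show "Poly_Mapping.keys (D1 n q u (e k)) \<subseteq> S"
    unfolding D1_def linear_ext_e by (intro keys_scale_subset) simp
qed

lemma keys_kappa1_carried:
  assumes "l \<noteq> []" "Poly_Mapping.keys f \<subseteq> carried i 0 s l"
  shows "Poly_Mapping.keys (kappa1 f) \<subseteq> carried i 0 (s + 1) l"
proof (rule tlin_keys[OF tlin_kappa1 assms(2) length_carried])
  fix j assume "j \<in> carried i 0 s l"
  then obtain m where j: "j = phys i 0 s m" and m: "length m = length l" "preceq m l"
    by (auto simp: carried_def)
  have "m \<noteq> []" using m(1) assms(1) by auto
  with j have "kappa1 (e j) = e (phys i 0 (s + 1) m)"
    using phys_shift[of m i s "-1"] by (simp add: kappa1_def)
  then show "Poly_Mapping.keys (kappa1 (e j)) \<subseteq> carried i 0 (s + 1) l"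
    using m by (simp add: carried_memI)
qed

lemma keys_kappa1_pow_carried:
  assumes "l \<noteq> []" "Poly_Mapping.keys f \<subseteq> carried i 0 s l"
  shows "Poly_Mapping.keys ((kappa1 ^^ k) f) \<subseteq> carried i 0 (s + int k) l"
proof (induction k)
  case (Suc k)
  show ?case using keys_kappa1_carried[OF assms(1) Suc] by (simp add: add.commute add.left_commute)
qed (use assms in simp)

lemma keys_Y_pow_carried:
  assumes "l \<noteq> []" "Poly_Mapping.keys f \<subseteq> carried i 0 s l"
  shows "Poly_Mapping.keys (Y_pow n 1 1 f) \<subseteq> carried i 0 (s - int n) l"
proof (rule tlin_keys[OF tlin_Y_pow assms(2) length_carried])
  fix j assume "j \<in> carried i 0 s l"
  then obtain m where j: "j = phys i 0 s m" and m: "length m = length l" "preceq m l"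
    by (auto simp: carried_def)
  have "m \<noteq> []" using m(1) assms(1) by auto
  with j have "Y_pow n 1 1 (e j) = e (phys i 0 (s - int n) m)"
    using phys_shift[of m i s "int n"] by (simp add: Y_pow_def)
  then show "Poly_Mapping.keys (Y_pow n 1 1 (e j)) \<subseteq> carried i 0 (s - int n) l"
    using m by (simp add: carried_memI)
qed

lemma keys_pi_op_carried:
  assumes "l \<noteq> []" "Poly_Mapping.keys f \<subseteq> carried i (length l - 1) s l"
  shows "Poly_Mapping.keys (pi_op n ntw (length l) q u f) \<subseteq> carried i 0 (s + int ntw) l"
proof -
  have "Poly_Mapping.keys (comps (map s_fac [1..<length l]) f) \<subseteq> carried i 0 s l"
    using keys_comps_s_fac_carried[OF _ assms(2)] assms(1) by simp
  then have "Poly_Mapping.keys (D1 n q u (comps (map s_fac [1..<length l]) f)) \<subseteq> carried i 0 s l"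
    by (rule keys_D1) (rule length_carried)
  from keys_kappa1_pow_carried[OF assms(1) this] show ?thesis
    by (simp add: pi_op_def)
qed

text \<open>It serves with \<open>a = i\<close> and \<open>s = 0\<close> when \<open>X1_inv\<close>
  absorbs the initial generators of \<open>B\<close>, and with \<open>a = 0\<close> and
  \<open>s > 0\<close>, where the product of generators is empty, for the other factors
  \<open>X1_inv\<close> of \<open>B1\<close>.\<close>

lemma keys_X1_inv_comps_T_carried:
  assumes "n \<ge> 1" "q \<noteq> 0" "v \<noteq> 0" "\<And>a. a < n \<Longrightarrow> u a \<noteq> 0"
    and "i < length l" "a < length l" "0 \<le> s" "s < int n" "s = 0 \<Longrightarrow> i \<le> a"
    and "Poly_Mapping.keys f \<subseteq> carried i a s l"
  shows "Poly_Mapping.keys (X1_inv n ntw (length l) q v u (comps (map (T n (length l) v) [1..<Suc a]) f))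
    \<subseteq> carried i 0 (s + int ntw) l"
proof -
  have N: "Suc (length l - 1) = length l" using assms(5) by simp
  have f: "f \<in> tensor_space (length l)"
    using assms(10) length_carried by (auto simp: tensor_space_iff)
  have "Poly_Mapping.keys (comps (map (Tinv n (length l) v) (rev [Suc a..<length l])) f)
      \<subseteq> carried i (length l - 1) s l"
    using keys_comps_Tinv_carried[OF assms(1,5,7,8,9,10), of "length l - 1" v] assms(6)
    unfolding N by linarith
  then have "Poly_Mapping.keys (pi_op n ntw (length l) q u
      (comps (map (Tinv n (length l) v) (rev [Suc a..<length l])) f)) \<subseteq> carried i 0 (s + int ntw) l"
    using assms(5) by (intro keys_pi_op_carried) auto
  then show ?thesis
    using assms f by (subst X1_inv_comps_T) auto
qed

text \<open>When \<open>Z\<^sub>k = X\<^sub>1\<^sup>-\<^sup>1\<close> with \<open>k < n'' + n'\<close>, the shift \<open>d (k n'' mod (n'' + n'))\<close> lies in \<open>{0<..<n}\<close>: it is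
  positive because \<open>n'' + n'\<close> is coprime to \<open>n''\<close>, and a step of the staircase forces \<open>k n'' mod (n'' + n') < n''\<close>.\<close>

lemma keys_Z_carried:
  assumes "n \<ge> 1" "ntw \<ge> 1" "q \<noteq> 0" "v \<noteq> 0" "\<And>a. a < n \<Longrightarrow> u a \<noteq> 0" "i < length l"
  defines "d \<equiv> gcd n ntw"
  defines "n2 \<equiv> n div d" and "n1 \<equiv> ntw div d"
  assumes "Suc k < n2 + n1" "Poly_Mapping.keys f \<subseteq> carried i 0 (int (d * ((Suc k * n2) mod (n2 + n1)))) l"
  shows "Poly_Mapping.keys (Z n ntw (length l) q v u (Suc k) f)
    \<subseteq> carried i 0 (int (d * ((k * n2) mod (n2 + n1)))) l"
proof -
  define M where "M = n2 + n1"
  define r where "r = (k * n2) mod M"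
  have d: "d > 0" "n = d * n2" "ntw = d * n1"
    using assms(1) by (simp_all add: d_def n2_def n1_def)
  have "n2 > 0" "n1 > 0" using d assms(1,2) by (auto intro!: gr0I)
  then have M: "M > 0" and r: "r < M" by (simp_all add: M_def r_def)
  have "coprime n2 n1"
    using assms(1) unfolding n2_def n1_def d_def by (intro div_gcd_coprime) auto
  then have "coprime M n2" 
    unfolding M_def coprime_iff_gcd_eq_1 by (metis add.commute gcd.commute gcd_add1)
  have "k * n2 = M * (k * n2 div M) + r" by (simp add: r_def)
  then have split: "Suc k * n2 = M * (k * n2 div M) + (r + n2)" by simp
  have Z: "Z n ntw (length l) q v u (Suc k) = (if (Suc k * n2) div M = (k * n2) div M
      then Y_pow n 1 1 else X1_inv n ntw (length l) q v u)"
    by (simp add: Z_def Let_def d_def n2_def n1_def M_def)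
  have ne: "l \<noteq> []" using assms(6) by auto
  have keys: "Poly_Mapping.keys f \<subseteq> carried i 0 (int (d * ((Suc k * n2) mod M))) l"
    using assms(11) unfolding M_def .
  have "Poly_Mapping.keys (Z n ntw (length l) q v u (Suc k) f) \<subseteq> carried i 0 (int (d * r)) l"
  proof (cases "r + n2 < M")
    case True
    \<comment> \<open>The quotient does not jump, so the factor is the first variable; it lowers the
      shift by \<open>n = d * n2\<close>.\<close>
    then have "(Suc k * n2) div M = (k * n2) div M" "(Suc k * n2) mod M = r + n2"
      unfolding split using M by simp_all
    moreover from this have "int (d * ((Suc k * n2) mod M)) - int n = int (d * r)"
      using d(2) by (simp add: distrib_left)
    ultimately show ?thesis
      using keys_Y_pow_carried[OF ne keys, of n] unfolding Z by (simp only: if_True simp_thms)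
  next
    case False
    \<comment> \<open>The quotient jumps and the residue wraps around to \<open>c = r - n1\<close>;
      \<open>X1_inv\<close> adds \<open>ntw = d * n1\<close> and so turns the shift
      \<open>d * c\<close> into \<open>d * r\<close>.\<close>
    then obtain c where c: "r + n2 = M + c" by (metis le_iff_add not_less)
    then have c_less: "c < n2" "c < M" and r_eq: "r = c + n1" using r by (simp_all add: M_def)
    define Q where "Q = k * n2 div M + 1"
    have *: "Suc k * n2 = M * Q + c"
      using split c by (simp add: Q_def distrib_left)
    have "(Suc k * n2) div M = Q" and mod: "(Suc k * n2) mod M = c"
      unfolding * using c_less(2) M by simp_all
    then have div: "(Suc k * n2) div M = k * n2 div M + 1" by (simp add: Q_def)
    have "c \<noteq> 0"
    proof
      assume "c = 0"
      then have "M dvd Suc k * n2" using mod by (simp add: mod_eq_0_iff_dvd)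
      then have "M dvd Suc k" using \<open>coprime M n2\<close> coprime_dvd_mult_left_iff by blast
      then show False using assms(10) by (auto simp: M_def dest: dvd_imp_le)
    qed
    then have s: "0 \<le> int (d * c)" "int (d * c) < int n" "int (d * c) = 0 \<Longrightarrow> i \<le> 0"
      using c_less(1) d by auto
    have "0 < length l" using ne by simp
    have "Poly_Mapping.keys (X1_inv n ntw (length l) q v u f) \<subseteq> carried i 0 (int (d * c) + int ntw) l"
      using keys_X1_inv_comps_T_carried[OF assms(1,3,4,5,6) \<open>0 < length l\<close> s keys[unfolded mod], where ntw = ntw]
      by simp
    moreover have "int (d * c) + int ntw = int (d * r)"
      using d(3) r_eq by (simp add: distrib_left)
    ultimately show ?thesis unfolding Z div by simp
  qed
  then show ?thesis by (simp add: r_def M_def)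
qed

text \<open>The factor of index \<open>k\<close> acts first, so the induction peels it off and
  follows the residues of \<open>k * n2\<close> down to 0.\<close>

lemma keys_comps_Z_carried:
  assumes "n \<ge> 1" "ntw \<ge> 1" "q \<noteq> 0" "v \<noteq> 0" "\<And>a. a < n \<Longrightarrow> u a \<noteq> 0" "i < length l"
  defines "d \<equiv> gcd n ntw"
  defines "n2 \<equiv> n div d" and "n1 \<equiv> ntw div d"
  assumes "k < n2 + n1" "Poly_Mapping.keys f \<subseteq> carried i 0 (int (d * ((k * n2) mod (n2 + n1)))) l"
  shows "Poly_Mapping.keys (comps (map (Z n ntw (length l) q v u) [1..<Suc k]) f) \<subseteq> carried i 0 0 l"
  using assms(10,11)
proof (induction k arbitrary: f)
  case (Suc k)
  have "Poly_Mapping.keys (Z n ntw (length l) q v u (Suc k) f)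
      \<subseteq> carried i 0 (int (d * ((k * n2) mod (n2 + n1)))) l"
    unfolding d_def n2_def n1_def
    by (rule keys_Z_carried[OF assms(1-6)]) (use Suc.prems in \<open>simp_all add: d_def n2_def n1_def\<close>)
  then show ?case using Suc by simp
qed simp

text \<open>The last factor of \<open>B1\<close> is \<open>X1_inv\<close>; it absorbs the initial
  generators and leaves the shift \<open>ntw\<close>. This is the staircase shift at index
  \<open>M - 1\<close>, so the remaining factors bring it to 0 with the entry in front, and the
  final generators carry it home.\<close>

lemma keys_B:
  assumes "n \<ge> 1" "ntw \<ge> 1" "q \<noteq> 0" "v \<noteq> 0" "\<And>a. a < n \<Longrightarrow> u a \<noteq> 0" "i < length l"
  shows "Poly_Mapping.keys (B n ntw (length l) q v u (Suc i) (e l)) \<subseteq> {m. length m = length l \<and> preceq m l}"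
proof -
  define d where "d = gcd n ntw"
  define n2 n1 where "n2 = n div d" and "n1 = ntw div d"
  define M where "M = n2 + n1"
  let ?Z = "Z n ntw (length l) q v u" and ?T = "comps (map (T n (length l) v) [1..<Suc i])"
  have d: "d > 0" "n = d * n2" "ntw = d * n1"
    using assms(1) by (simp_all add: d_def n2_def n1_def)
  have pos: "n2 > 0" "n1 > 0" using d assms(1,2) by (auto intro!: gr0I)
  then have "M > 0" by (simp add: M_def)
  then obtain K where K: "M = Suc K" using gr0_implies_Suc by blast
  have "phys i i 0 l \<in> carried i i 0 l" by (rule carried_memI) (simp_all add: preceq_def)
  then have "Poly_Mapping.keys (e l) \<subseteq> carried i i 0 l" by (simp add: phys_id)
  then have X: "Poly_Mapping.keys (X1_inv n ntw (length l) q v u (?T (e l))) \<subseteq> carried i 0 (0 + int ntw) l"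
    using assms(1) by (intro keys_X1_inv_comps_T_carried[OF assms(1,3,4,5,6,6)]) auto
  \<comment> \<open>At index \<open>M\<close> the quotient reaches \<open>n2\<close> for the first
    time, so the last factor is \<open>X1_inv\<close>.\<close>
  have "K * n2 div M < n2" using pos K by (simp add: div_less_iff_less_mult)
  moreover have "M * n2 div M = n2" using \<open>M > 0\<close> by (intro nonzero_mult_div_cancel_left) simp
  moreover have "M - 1 = K" using K by simp
  ultimately have "M * n2 div M \<noteq> (M - 1) * n2 div M" by simp
  then have ZM: "?Z M = X1_inv n ntw (length l) q v u"
    unfolding Z_def Let_def d_def[symmetric] n2_def[symmetric] n1_def[symmetric] M_def[symmetric]
    by (rule if_not_P)
  have "K * n2 mod M = n1"
  proof -
    \<comment> \<open>Modulo \<open>M = n2 + n1\<close>, the number \<open>(M - 1) * n2\<close> is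
      congruent to \<open>- n2\<close>, hence to \<open>n1\<close>.\<close>
    have "K * n2 = M * (n2 - 1) + n1"
    proof -
      obtain b where "n2 = Suc b" using pos by (cases n2) auto
      then show ?thesis using K by (simp add: M_def algebra_simps)
    qed
    then show ?thesis using pos by (simp add: M_def)
  qed
  then have "Poly_Mapping.keys (?Z M (?T (e l))) \<subseteq> carried i 0 (int (d * (K * n2 mod M))) l"
    using X ZM d(3) by simp
  then have "Poly_Mapping.keys (comps (map ?Z [1..<Suc K]) (?Z M (?T (e l)))) \<subseteq> carried i 0 0 l"
    using K unfolding d_def n2_def n1_def M_def
    by (intro keys_comps_Z_carried[OF assms]) simp_all
  moreover have "B1 n ntw (length l) q v u (?T (e l)) = comps (map ?Z [1..<Suc K]) (?Z M (?T (e l)))"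
    using K by (simp add: B1_def Let_def flip: d_def n2_def n1_def M_def)
  ultimately have "Poly_Mapping.keys (B1 n ntw (length l) q v u (?T (e l))) \<subseteq> carried i 0 0 l" by simp
  then have "Poly_Mapping.keys (comps (map (T n (length l) v) (rev [1..<Suc i]))
      (B1 n ntw (length l) q v u (?T (e l)))) \<subseteq> carried i i 0 l"
    by (rule keys_comps_T_carried[OF assms(1) order_refl assms(6)])
  moreover have "carried i i 0 l = {m. length m = length l \<and> preceq m l}"
    by (auto simp: carried_def phys_id)
  ultimately show ?thesis by (simp add: B_def)
qed

theorem theorem3p2:
  fixes n ntw N i :: nat and q v :: complex and u :: "nat \<Rightarrow> complex" and l :: weight
  assumes "n \<ge> 1" and "ntw \<ge> 1" and "N \<ge> 1"
    and "q \<noteq> 0" and "v \<noteq> 0" and "\<And>a. a < n \<Longrightarrow> u a \<noteq> 0"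
    and "i \<in> {1..N}" and "length l = N"
  shows "\<exists>(c :: complex) (S :: weight set) (d :: weight \<Rightarrow> complex).
           finite S \<and> (\<forall>\<mu>\<in>S. length \<mu> = N \<and> prec \<mu> l) \<and>
           B n ntw N q v u i (e l) = scale c (e l) + (\<Sum>\<mu>\<in>S. scale (d \<mu>) (e \<mu>))"
proof -
  let ?f = "B n ntw N q v u i (e l)"
  let ?S = "Poly_Mapping.keys ?f - {l}"
  have "i - 1 < length l" "Suc (i - 1) = i" using assms(7,8) by auto
  then have "Poly_Mapping.keys ?f \<subseteq> {m. length m = N \<and> preceq m l}"
    using keys_B[where i = "i - 1" and l = l and u = u, OF assms(1,2,4,5,6)] assms(8) by simp
  then have "\<forall>\<mu>\<in>?S. length \<mu> = N \<and> prec \<mu> l"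
    by (auto simp: preceq_def)
  moreover have "?f = (\<Sum>m\<in>insert l ?S. scale (Poly_Mapping.lookup ?f m) (e m))"
    by (rule vec_expansion) auto
  then have "?f = scale (Poly_Mapping.lookup ?f l) (e l) + (\<Sum>m\<in>?S. scale (Poly_Mapping.lookup ?f m) (e m))"
    by (subst (asm) sum.insert) auto
  ultimately show ?thesis
    by (intro exI[of _ "Poly_Mapping.lookup ?f l"] exI[of _ ?S] exI[of _ "Poly_Mapping.lookup ?f"] conjI)
      simp_all
qed

end
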